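(* For every graph $H$, every integer $r \geq 300\,v(H)^9$, every positive integer $n$, and every $n$-vertex graph $G$ containing no $K_{r+1}$ as a subgraph, we have $\mathrm{inj}(H,G) \leq \mathrm{inj}(H,T_r(n))$.
   Context: $v(H)$ denotes the number of vertices of $H$. A map $\varphi:V(H)\to V(G)$ is a homomorphism from $H$ to $G$ if $\varphi(u)\varphi(v)\in E(G)$ for every $uv\in E(H)$. $\mathrm{inj}(H,G)$ denotes the number of injective homomorphisms from $H$ to $G$. $T_r(n)$ is the complete $r$-partite graph on $n$ vertices whose parts have sizes $\lfloor n/r\rfloor$ or $\lceil n/r\rceil$ (so $T_r(n)=K_n$ if $n\le r$). *)

theory Defs
  imports "HOL-Library.FuncSet"
begin

definition sgraph :: "'a set \<Rightarrow> ('a \<Rightarrow> 'a \<Rightarrow> bool) \<Rightarrow> bool" where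
  "sgraph V E \<longleftrightarrow> finite V \<and> (\<forall>u v. E u v \<longrightarrow> u \<in> V \<and> v \<in> V)
     \<and> (\<forall>u v. E u v \<longrightarrow> E v u) \<and> (\<forall>v. \<not> E v v)"

definition graph_hom :: "'a set \<Rightarrow> ('a \<Rightarrow> 'a \<Rightarrow> bool) \<Rightarrow> 'b set \<Rightarrow> ('b \<Rightarrow> 'b \<Rightarrow> bool)
    \<Rightarrow> ('a \<Rightarrow> 'b) \<Rightarrow> bool" where
  "graph_hom VH EH VG EG f \<longleftrightarrow> f \<in> VH \<rightarrow>\<^sub>E VG \<and> (\<forall>u v. EH u v \<longrightarrow> EG (f u) (f v))"

definition inj_count :: "'a set \<Rightarrow> ('a \<Rightarrow> 'a \<Rightarrow> bool) \<Rightarrow> 'b set \<Rightarrow> ('b \<Rightarrow> 'b \<Rightarrow> bool) \<Rightarrow> nat" where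
  "inj_count VH EH VG EG = card {f. graph_hom VH EH VG EG f \<and> inj_on f VH}"

definition contains_clique :: "'b set \<Rightarrow> ('b \<Rightarrow> 'b \<Rightarrow> bool) \<Rightarrow> nat \<Rightarrow> bool" where
  "contains_clique V E k \<longleftrightarrow> (\<exists>S \<subseteq> V. card S = k \<and> (\<forall>u\<in>S. \<forall>v\<in>S. u \<noteq> v \<longrightarrow> E u v))"

text \<open>Turan graph T_r(n): vertices 0..n-1, part of i is i mod r (parts have sizes
  floor(n/r) or ceil(n/r)); two vertices adjacent iff in different parts.\<close>
definition turan_V :: "nat \<Rightarrow> nat set" where
  "turan_V n = {0..<n}"

definition turan_E :: "nat \<Rightarrow> nat \<Rightarrow> nat \<Rightarrow> nat \<Rightarrow> bool" where
  "turan_E r n i j \<longleftrightarrow> i < n \<and> j < n \<and> i mod r \<noteq> j mod r"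

end

theory Submission
  imports Defs
begin

text \<open>
  Let k be the number of vertices of H and let G be a graph with the maximal number of embeddings
  of H among the graphs on n vertices without K_{r+1}; only n > r is of interest.
  Replacing a vertex of G by a clone of a vertex lying in an average number of embeddings creates
  no K_{r+1}, so extremality forces every vertex of G to have at most O(k^3 n / r) non-neighbours.
  Furedi's stability argument (repeatedly split off the non-neighbours of a vertex of maximal
  degree) colours the vertices with r colours such that the non-adjacent bichromatic pairs are at
  least twice as many as the adjacent monochromatic ones. All degrees in the complement being
  small, every non-adjacent bichromatic pair costs at least half as many embeddings as an adjacent
  monochromatic pair can yield, so the complete multipartite graph of the colouring is extremal as
  well. If it had parts of sizes a and b with a at least b + 2, moving a vertex from the larger to
  the smaller part would strictly increase the number of embeddings. Hence it is the Turan graph.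
\<close>

section \<open>Counting injections\<close>

text \<open>The map \<open>g\<close> on \<open>X\<close> is the part of an embedding that is already
  decided. Extensionality outside \<open>A\<close> makes cardinality the right count.\<close>

definition pinj :: "'a set \<Rightarrow> 'b set \<Rightarrow> 'a set \<Rightarrow> ('a \<Rightarrow> 'b) \<Rightarrow> ('a \<Rightarrow> 'b) set" where
  "pinj A V X g = {f \<in> A \<rightarrow>\<^sub>E V. inj_on f A \<and> (\<forall>x\<in>X. f x = g x)}"

text \<open>The edges of the counted graph enter as a set of pairs, not as a symmetric relation, so
  that each edge can be listed once and \<open>card P\<close> is then the number of edges.\<close>

definition emb :: "'a set \<Rightarrow> ('a \<times> 'a) set \<Rightarrow> 'b set \<Rightarrow> ('b \<Rightarrow> 'b \<Rightarrow> bool) \<Rightarrow> ('a \<Rightarrow> 'b) set" where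
  "emb A P V E = {f \<in> A \<rightarrow>\<^sub>E V. inj_on f A \<and> (\<forall>(x, y)\<in>P. E (f x) (f y))}"

lemma finite_pinj: "finite A \<Longrightarrow> finite V \<Longrightarrow> finite (pinj A V X g)"
  unfolding pinj_def by (rule finite_subset[of _ "A \<rightarrow>\<^sub>E V"]) (auto intro: finite_PiE)

lemma finite_emb: "finite A \<Longrightarrow> finite V \<Longrightarrow> finite (emb A P V E)"
  unfolding emb_def by (rule finite_subset[of _ "A \<rightarrow>\<^sub>E V"]) (auto intro: finite_PiE)

lemma restrict_mem_pinj:
  assumes "f \<in> pinj (insert w A) V X g" "X \<subseteq> A"
  shows "restrict f A \<in> pinj A V X g"
  using assms unfolding pinj_def by (auto simp: PiE_iff inj_on_def)

text \<open>An injection on \<open>insert w A\<close> is one on \<open>A\<close> together with a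
  value of \<open>w\<close> outside its image, and this image always has \<open>card A\<close>
  elements.\<close>

lemma card_pinj_insert:
  assumes "finite V" "finite A" "w \<notin> A" "X \<subseteq> A"
  shows "card (pinj (insert w A) V X g) = (card V - card A) * card (pinj A V X g)"
proof -
  have "bij_betw (\<lambda>f. (restrict f A, f w)) (pinj (insert w A) V X g)
          (Sigma (pinj A V X g) (\<lambda>f. V - f ` A))"
  proof (rule bij_betw_byWitness[where f' = "\<lambda>(f, v). f(w := v)"])
    show "\<forall>f\<in>pinj (insert w A) V X g. (\<lambda>(f, v). f(w := v)) (restrict f A, f w) = f"
      by (auto simp: pinj_def fun_eq_iff PiE_iff extensional_def)
    show "\<forall>z\<in>Sigma (pinj A V X g) (\<lambda>f. V - f ` A).
        (\<lambda>f. (restrict f A, f w)) ((\<lambda>(f, v). f(w := v)) z) = z"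
      using assms(3) by (auto simp: pinj_def fun_eq_iff PiE_iff extensional_def)
    show "(\<lambda>f. (restrict f A, f w)) ` pinj (insert w A) V X g \<subseteq> Sigma (pinj A V X g) (\<lambda>f. V - f ` A)"
      using assms(3,4) restrict_mem_pinj[OF _ assms(4)] by (auto simp: pinj_def PiE_iff)
    show "(\<lambda>(f, v). f(w := v)) ` Sigma (pinj A V X g) (\<lambda>f. V - f ` A) \<subseteq> pinj (insert w A) V X g"
    proof clarify
      fix f v assume *: "f \<in> pinj A V X g" "v \<in> V" "v \<notin> f ` A"
      have "inj_on (f(w := v)) (insert w A)"
        using * assms(3) by (auto simp: pinj_def intro: inj_on_fun_updI)
      moreover have "f(w := v) \<in> insert w A \<rightarrow>\<^sub>E V"
        using * by (auto simp: pinj_def PiE_iff extensional_def)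
      ultimately show "f(w := v) \<in> pinj (insert w A) V X g"
        using * assms(3,4) by (auto simp: pinj_def)
    qed
  qed
  then have "card (pinj (insert w A) V X g) = card (Sigma (pinj A V X g) (\<lambda>f. V - f ` A))"
    by (rule bij_betw_same_card)
  also have "\<dots> = (\<Sum>f\<in>pinj A V X g. card (V - f ` A))"
    using assms by (intro card_SigmaI) (auto intro: finite_pinj)
  also have "\<dots> = (\<Sum>f\<in>pinj A V X g. card V - card A)"
  proof (rule sum.cong[OF refl])
    fix f assume "f \<in> pinj A V X g"
    then have "f ` A \<subseteq> V" "inj_on f A" by (auto simp: pinj_def)
    then show "card (V - f ` A) = card V - card A"
      using assms by (simp add: card_Diff_subset card_image)
  qed
  finally show ?thesis by simp
qed

text \<open>The free points of \<open>A\<close> are added one at a time. If \<open>V\<close> is too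
  small for an injection, the product contains a factor 0, so truncated subtraction does no
  harm.\<close>

lemma card_pinj:
  assumes "finite V" "finite A" "X \<subseteq> A" "inj_on g X" "g ` X \<subseteq> V"
  shows "card (pinj A V X g) = (\<Prod>i = card X..<card A. card V - i)"
proof -
  have finX: "finite X" using assms finite_subset by blast
  have "card (pinj (X \<union> C) V X g) = (\<Prod>i = card X..<card (X \<union> C). card V - i)"
    if "finite C" "C \<inter> X = {}" for C
    using that
  proof (induction C)
    case empty
    have "pinj X V X g = {restrict g X}"
      using assms(4,5)
      by (auto simp: pinj_def PiE_iff extensional_def fun_eq_iff inj_on_def)
    then show ?case by simp
  next
    case (insert w C)
    have "card (pinj (insert w (X \<union> C)) V X g) = (card V - card (X \<union> C)) * card (pinj (X \<union> C) V X g)"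
      using insert finX assms(1) by (intro card_pinj_insert) auto
    moreover have "card (insert w (X \<union> C)) = Suc (card (X \<union> C))" "card X \<le> card (X \<union> C)"
      using insert finX by (auto intro: card_mono)
    ultimately show ?case using insert by (simp add: prod.atLeastLessThan_Suc)
  qed
  from this[of "A - X"] show ?thesis using assms(2,3) by (simp add: Un_absorb1 Int_commute Diff_disjoint)
qed

section \<open>Injections with a confined value, and the union bound\<close>

text \<open>Choose the value of \<open>w\<close> last: at most \<open>D\<close> values are left for
  it, against at least \<open>card V / 2\<close> in an unrestricted injection. So \<open>S\<close>
  is at most a fraction \<open>2 * D / card V\<close> of all injections. The set \<open>R\<close>
  may depend on the values chosen before.\<close>

lemma card_pinj_restricted_le:
  assumes "finite V" "finite A" "X \<subseteq> A" "inj_on g X" "g ` X \<subseteq> V"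
    and "w \<in> A" "w \<notin> X" "2 * card A \<le> card V"
    and S: "S \<subseteq> pinj A V X g"
    and R: "\<And>f. f \<in> S \<Longrightarrow> f w \<in> R (restrict f (A - {w}))"
    and D: "\<And>f. f \<in> pinj (A - {w}) V X g \<Longrightarrow> finite (R f) \<and> card (R f) \<le> D"
  shows "card V * card S \<le> 2 * D * (\<Prod>i = card X..<card A. card V - i)"
proof -
  define A' where "A' = A - {w}"
  have A: "A = insert w A'" "w \<notin> A'" "finite A'" "X \<subseteq> A'" using assms by (auto simp: A'_def)
  then have cA: "card A = Suc (card A')" by simp
  have cX: "card X \<le> card A'" using A by (simp add: card_mono)
  have "card S \<le> card (Sigma (pinj A' V X g) R)"
  proof (rule card_inj_on_le[where f = "\<lambda>f. (restrict f A', f w)"])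
    show "inj_on (\<lambda>f. (restrict f A', f w)) S"
    proof (rule inj_onI)
      fix f f' assume *: "f \<in> S" "f' \<in> S" "(restrict f A', f w) = (restrict f' A', f' w)"
      have "f x = f' x" if "x \<in> A" for x
      proof -
        have "restrict f A' x = restrict f' A' x" "f w = f' w" using *(3) by simp_all
        then show ?thesis using that A(1) by (cases "x = w") auto
      qed
      then show "f = f'" using * S by (intro PiE_ext[of f A "\<lambda>_. V"]) (auto simp: pinj_def)
    qed
    show "(\<lambda>f. (restrict f A', f w)) ` S \<subseteq> Sigma (pinj A' V X g) R"
      using S R restrict_mem_pinj[OF _ A(4), of _ w V g] unfolding A'_def[symmetric] A(1)[symmetric]
      by auto
    show "finite (Sigma (pinj A' V X g) R)"
      using A(3) assms(1) D unfolding A'_def[symmetric] by (auto intro!: finite_SigmaI finite_pinj)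
  qed
  also have "\<dots> = (\<Sum>f\<in>pinj A' V X g. card (R f))"
    using A(3) assms(1) D unfolding A'_def[symmetric] by (intro card_SigmaI) (auto intro!: finite_pinj)
  also have "\<dots> \<le> (\<Sum>f\<in>pinj A' V X g. D)"
    using D unfolding A'_def[symmetric] by (intro sum_mono) auto
  also have "\<dots> = D * (\<Prod>i = card X..<card A'. card V - i)"
    using card_pinj[OF assms(1) A(3,4) assms(4,5)] by simp
  finally have 1: "card S \<le> D * (\<Prod>i = card X..<card A'. card V - i)" .
  \<comment> \<open>The factor \<open>card V - card A'\<close> counts the values available to
    \<open>w\<close> in an unrestricted injection; it completes the product up to
    \<open>card A\<close>.\<close>
  have "card V \<le> 2 * (card V - card A')" using assms(8) cA by simp
  from mult_le_mono[OF this 1] show ?thesis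
    using cX by (simp add: cA prod.atLeastLessThan_Suc algebra_simps)
qed


text \<open>Union bound: every pair in \<open>P\<close> has an endpoint outside \<open>X\<close>, so
  at most a fraction \<open>2 * D / card V\<close> of the injections violates it. The loss stands on
  the right-hand side to avoid truncated subtraction.\<close>

lemma card_pinj_le_extensions:
  assumes "finite V" "finite A" "X \<subseteq> A" "inj_on g X" "g ` X \<subseteq> V" "2 * card A \<le> card V"
    and P: "P \<subseteq> A \<times> A" "\<And>z w. (z, w) \<in> P \<Longrightarrow> z \<noteq> w \<and> (z \<notin> X \<or> w \<notin> X)"
    and sym: "\<And>u v. E u v \<Longrightarrow> E v u"
    and D: "\<And>u. u \<in> V \<Longrightarrow> card {v \<in> V. v \<noteq> u \<and> \<not> E u v} \<le> D"
  defines "N \<equiv> (\<Prod>i = card X..<card A. card V - i)"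
  shows "card V * N \<le> card V * card {f \<in> pinj A V X g. \<forall>(z, w)\<in>P. E (f z) (f w)} + 2 * card P * D * N"
proof -
  define bad where "bad = (\<lambda>(z, w). {f \<in> pinj A V X g. \<not> E (f z) (f w)})"
  have finP: "finite P" using P(1) assms(2) by (meson finite_SigmaI finite_subset)
  have *: "card V * card {f \<in> pinj A V X g. \<not> E (f z) (f w)} \<le> 2 * D * N"
    if zw: "z \<in> A" "w \<in> A" "z \<noteq> w" "w \<notin> X" for z w
    unfolding N_def
  proof (rule card_pinj_restricted_le[where w = w and R = "\<lambda>f. {v \<in> V. v \<noteq> f z \<and> \<not> E (f z) v}"])
    fix f assume "f \<in> {f \<in> pinj A V X g. \<not> E (f z) (f w)}"
    then show "f w \<in> {v \<in> V. v \<noteq> restrict f (A - {w}) z \<and> \<not> E (restrict f (A - {w}) z) v}"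
      using zw by (auto simp: pinj_def inj_on_def)
  next
    fix f assume "f \<in> pinj (A - {w}) V X g"
    then have "f z \<in> V" using zw by (auto simp: pinj_def PiE_iff)
    then show "finite {v \<in> V. v \<noteq> f z \<and> \<not> E (f z) v} \<and> card {v \<in> V. v \<noteq> f z \<and> \<not> E (f z) v} \<le> D"
      using D assms(1) by auto
  qed (use assms zw in auto)
  \<comment> \<open>Whichever endpoint is free plays the role of \<open>w\<close>; symmetry of
    \<open>E\<close> exchanges the two.\<close>
  have bad: "card V * card (bad p) \<le> 2 * D * N" if "p \<in> P" for p
  proof -
    obtain z w where p: "p = (z, w)" by (cases p)
    have zw: "z \<in> A" "w \<in> A" "z \<noteq> w" "z \<notin> X \<or> w \<notin> X" using that p P by auto
    have "bad p = {f \<in> pinj A V X g. \<not> E (f z) (f w)}" "bad p = {f \<in> pinj A V X g. \<not> E (f w) (f z)}"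
      using sym unfolding bad_def p by auto
    then show ?thesis using *[of z w] *[of w z] zw by auto
  qed
  let ?good = "{f \<in> pinj A V X g. \<forall>(z, w)\<in>P. E (f z) (f w)}"
  have fin: "finite (pinj A V X g)" using assms by (simp add: finite_pinj)
  have "N = card (pinj A V X g)" using assms by (simp add: N_def card_pinj)
  also have "pinj A V X g \<subseteq> ?good \<union> (\<Union>p\<in>P. bad p)" by (auto simp: bad_def)
  then have "card (pinj A V X g) \<le> card (?good \<union> (\<Union>p\<in>P. bad p))"
    using fin finP by (intro card_mono) (auto simp: bad_def)
  also have "\<dots> \<le> card ?good + (\<Sum>p\<in>P. card (bad p))"
    using card_Un_le[of ?good "\<Union>p\<in>P. bad p"] card_UN_le[OF finP, of bad] by linarith
  finally have "card V * N \<le> card V * (card ?good + (\<Sum>p\<in>P. card (bad p)))"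
    by (rule mult_le_mono2)
  also have "\<dots> = card V * card ?good + (\<Sum>p\<in>P. card V * card (bad p))"
    by (simp add: distrib_left sum_distrib_left)
  also have "(\<Sum>p\<in>P. card V * card (bad p)) \<le> (\<Sum>p\<in>P. 2 * D * N)"
    by (rule sum_mono) (rule bad)
  finally show ?thesis by (simp add: algebra_simps)
qed

section \<open>Colourings of clique-free graphs and cloning\<close>

text \<open>Induction on \<open>r\<close>: the neighbourhood \<open>U'\<close> of a vertex
  \<open>x\<close> of maximal degree has no clique of size \<open>r + 1\<close> and is coloured
  recursively; the non-neighbours of \<open>x\<close> get the new colour \<open>r\<close>. The last
  conjunct puts each colour class inside the non-neighbours of one vertex, so that bounds on
  codegrees become bounds on class sizes.\<close>

lemma furedi_colouring:
  assumes sym: "\<And>u v. E u v \<Longrightarrow> E v u" and irr: "\<And>v. \<not> E v v"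
    and "finite U" "\<not> contains_clique U E (Suc r)"
  shows "\<exists>col. (\<forall>v\<in>U. col v < r)
    \<and> 2 * card (SIGMA u:U. {v \<in> U. E u v \<and> col v = col u}) \<le> card (SIGMA u:U. {v \<in> U. \<not> E u v \<and> col v \<noteq> col u})
    \<and> (\<forall>v\<in>U. \<exists>x\<in>U. {w \<in> U. col w = col v} \<subseteq> {w \<in> U. \<not> E x w})"
  using assms(3,4)
proof (induction r arbitrary: U)
  case 0
  have "U = {}"
  proof (rule ccontr)
    assume "U \<noteq> {}"
    then obtain x where "x \<in> U" by blast
    then have "contains_clique U E (Suc 0)"
      unfolding contains_clique_def by (intro exI[of _ "{x}"]) auto
    with 0 show False by simp
  qed
  then show ?case by simp
next
  case (Suc r)
  show ?case
  proof (cases "U = {}")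
    case False
    define dg where "dg = (\<lambda>u. card {v \<in> U. E u v})"
    have "Max (dg ` U) \<in> dg ` U" using Suc.prems(1) False by (intro Max_in) auto
    then obtain x where "x \<in> U" "dg x = Max (dg ` U)" by (metis imageE)
    then have x: "x \<in> U" "\<And>u. u \<in> U \<Longrightarrow> dg u \<le> dg x"
      using Suc.prems(1) by auto
    define U' where "U' = {v \<in> U. E x v}"
    define A where "A = U - U'"
    have U: "U = A \<union> U'" "A \<inter> U' = {}" "finite A" "finite U'"
      using Suc.prems(1) by (auto simp: A_def U'_def)
    have "\<not> contains_clique U' E (Suc r)"
    proof
      assume "contains_clique U' E (Suc r)"
      then obtain S where S: "S \<subseteq> U'" "card S = Suc r" "\<forall>u\<in>S. \<forall>v\<in>S. u \<noteq> v \<longrightarrow> E u v"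
        unfolding contains_clique_def by blast
      have "finite S" using S(2) by (metis card.infinite nat.distinct(1))
      have "x \<notin> S" using S(1) irr by (auto simp: U'_def)
      then have "contains_clique U E (Suc (Suc r))" unfolding contains_clique_def
        using S \<open>finite S\<close> x(1) sym by (intro exI[of _ "insert x S"]) (auto simp: U'_def)
      with Suc.prems show False by simp
    qed
    from Suc.IH[OF U(4) this] obtain col where col: "\<forall>v\<in>U'. col v < r"
      "2 * card (SIGMA u:U'. {v \<in> U'. E u v \<and> col v = col u}) \<le> card (SIGMA u:U'. {v \<in> U'. \<not> E u v \<and> col v \<noteq> col u})"
      "\<forall>v\<in>U'. \<exists>x\<in>U'. {w \<in> U'. col w = col v} \<subseteq> {w \<in> U'. \<not> E x w}"
      by blast
    define c where "c = (\<lambda>v. if v \<in> A then r else col v)"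
    have cA: "c v = r" if "v \<in> A" for v using that by (simp add: c_def)
    have cU: "c v = col v" "c v < r" if "v \<in> U'" for v using that U(2) col(1) by (auto simp: c_def)
    let ?B' = "SIGMA u:U'. {v \<in> U'. E u v \<and> col v = col u}"
    let ?M' = "SIGMA u:U'. {v \<in> U'. \<not> E u v \<and> col v \<noteq> col u}"
    let ?B = "SIGMA u:U. {v \<in> U. E u v \<and> c v = c u}"
    let ?M = "SIGMA u:U. {v \<in> U. \<not> E u v \<and> c v \<noteq> c u}"
    let ?BA = "SIGMA u:A. {v \<in> A. E u v}"
    let ?MA = "SIGMA u:A. {v \<in> U'. \<not> E u v}"
    have "card ?BA = (\<Sum>a\<in>A. card {v \<in> A. E a v})"
      using U by (intro card_SigmaI) auto
    also have "\<dots> \<le> (\<Sum>a\<in>A. card {v \<in> U'. \<not> E a v})"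
    proof (rule sum_mono)
      \<comment> \<open>Since \<open>a\<close> has at most \<open>card U'\<close> neighbours, each
        neighbour inside \<open>A\<close> is paid for by a non-neighbour in
        \<open>U'\<close>.\<close>
      fix a assume a: "a \<in> A"
      have "{v \<in> U. E a v} = {v \<in> A. E a v} \<union> {v \<in> U'. E a v}" using U by auto
      then have "dg a = card {v \<in> A. E a v} + card {v \<in> U'. E a v}"
        unfolding dg_def using U by (subst card_Un_disjoint[symmetric]) auto
      moreover have "dg a \<le> card U'"
      proof -
        have "a \<in> U" using a by (simp add: A_def)
        then show ?thesis using x(2)[of a] by (simp add: dg_def U'_def)
      qed
      moreover have "card U' = card {v \<in> U'. E a v} + card {v \<in> U'. \<not> E a v}"
        using U by (subst card_Un_disjoint[symmetric]) (auto intro: arg_cong[where f = card])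
      ultimately show "card {v \<in> A. E a v} \<le> card {v \<in> U'. \<not> E a v}" by linarith
    qed
    also have "\<dots> = card ?MA" using U by (intro card_SigmaI[symmetric]) auto
    finally have 1: "card ?BA \<le> card ?MA" .
    have "?B \<subseteq> ?B' \<union> ?BA"
      using U cA cU by (auto, (metis less_irrefl)+)
    then have "card ?B \<le> card (?B' \<union> ?BA)" using U by (intro card_mono) auto
    then have 2: "card ?B \<le> card ?B' + card ?BA" using card_Un_le[of ?B' ?BA] by linarith
    have finMA: "finite ?MA" using U by auto
    \<comment> \<open>All pairs are ordered. \<open>?BA\<close> already contains both orders of an
      edge inside \<open>A\<close>, while \<open>?MA\<close> contains only one order of a missing
      pair; adding the converse yields the factor 2.\<close>
    have "?M' \<union> (?MA \<union> ?MA\<inverse>) \<subseteq> ?M"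
      using U cA cU sym by (auto, (metis less_irrefl)+)
    then have "card (?M' \<union> (?MA \<union> ?MA\<inverse>)) \<le> card ?M"
      using Suc.prems(1) by (intro card_mono) auto
    moreover have "card (?M' \<union> (?MA \<union> ?MA\<inverse>)) = card ?M' + card (?MA \<union> ?MA\<inverse>)"
      using U finMA by (intro card_Un_disjoint) auto
    moreover have "card (?MA \<union> ?MA\<inverse>) = card ?MA + card (?MA\<inverse>)"
      using U finMA by (intro card_Un_disjoint) auto
    ultimately have 3: "card ?M' + 2 * card ?MA \<le> card ?M" by (simp add: card_inverse)
    have "\<exists>x\<in>U. {w \<in> U. c w = c v} \<subseteq> {w \<in> U. \<not> E x w}" if "v \<in> U" for v
    proof (cases "v \<in> A")
      case True
      have "w \<notin> U'" if "c w = c v" for w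
        using that cA[OF True] cU(2)[of w] by auto
      then have "{w \<in> U. c w = c v} \<subseteq> {w \<in> U. \<not> E x w}" by (auto simp: U'_def)
      then show ?thesis using x(1) by blast
    next
      case False
      then have v: "v \<in> U'" using that U by auto
      with col(3) obtain y where y: "y \<in> U'" "{w \<in> U'. col w = col v} \<subseteq> {w \<in> U'. \<not> E y w}" by blast
      have "\<not> E y w" if w: "w \<in> U" "c w = c v" for w
      proof -
        have w': "w \<in> U'" using w U(1) cA[of w] cU(2)[OF v] by auto
        then have "col w = col v" using w(2) cU(1)[OF w'] cU(1)[OF v] by simp
        then show ?thesis using w' y(2) by blast
      qed
      then have "{w \<in> U. c w = c v} \<subseteq> {w \<in> U. \<not> E y w}" by blast
      moreover have "y \<in> U" using y(1) U(1) by simp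
      ultimately show ?thesis by blast
    qed
    moreover have "\<forall>v\<in>U. c v < Suc r" using U cA cU by (auto simp: less_Suc_eq)
    ultimately show ?thesis using 1 2 3 col(2) by (intro exI[of _ c]) auto
  qed simp
qed

section \<open>Pullbacks and vertex cloning\<close>

text \<open>Irreflexivity of \<open>E\<close> makes \<open>s\<close> injective on every clique of
  the pullback, so the image is a clique of the same size. This serves both for cloning a vertex and
  for renaming the vertices.\<close>

lemma clique_free_pullback:
  assumes irr: "\<And>v. \<not> E v v" and "s ` V \<subseteq> W" "\<not> contains_clique W E m"
  shows "\<not> contains_clique V (\<lambda>a b. E (s a) (s b)) m"
proof
  assume "contains_clique V (\<lambda>a b. E (s a) (s b)) m"
  then obtain S where S: "S \<subseteq> V" "card S = m" "\<forall>a\<in>S. \<forall>b\<in>S. a \<noteq> b \<longrightarrow> E (s a) (s b)"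
    unfolding contains_clique_def by blast
  have "inj_on s S" using S(3) irr by (metis inj_onI)
  then have "card (s ` S) = m" using S(2) by (simp add: card_image)
  moreover have "s ` S \<subseteq> W" using S(1) assms(2) by auto
  moreover have "\<forall>a\<in>s ` S. \<forall>b\<in>s ` S. a \<noteq> b \<longrightarrow> E a b" using S(3) by auto
  ultimately show False using assms(3) unfolding contains_clique_def by blast
qed

text \<open>Pulling back along \<open>id(v := u)\<close> replaces \<open>v\<close> by a twin of
  \<open>u\<close>. Embeddings that avoid \<open>v\<close> survive, and each of them that uses
  \<open>u\<close> gives a second one by rerouting from \<open>u\<close> to
  \<open>v\<close>.\<close>

lemma clone_emb:
  assumes "finite A" "finite V" "u \<in> V" "v \<in> V" "P \<subseteq> A \<times> A"
  shows "card (emb A P V E) + card {f \<in> emb A P V E. u \<in> f ` A}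
    \<le> card (emb A P V (\<lambda>a b. E ((id(v := u)) a) ((id(v := u)) b)))
      + card {f \<in> emb A P V E. v \<in> f ` A} + card {f \<in> emb A P V E. u \<in> f ` A \<and> v \<in> f ` A}"
proof -
  let ?s = "id(v := u)"
  let ?G = "emb A P V E" and ?G' = "emb A P V (\<lambda>a b. E (?s a) (?s b))"
  let ?T1 = "{f \<in> ?G. v \<notin> f ` A}" and ?T2 = "{f \<in> ?G. u \<in> f ` A \<and> v \<notin> f ` A}"
  define t where "t = (\<lambda>f :: 'a \<Rightarrow> 'b. restrict (\<lambda>x. if f x = u then v else f x) A)"
  have fin: "finite ?G" "finite ?G'" using assms by (auto intro: finite_emb)
  have T1: "?T1 \<subseteq> ?G'"
  proof clarify
    fix f assume f: "f \<in> ?G" "v \<notin> f ` A"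
    have "E (?s (f x)) (?s (f y))" if "(x, y) \<in> P" for x y
    proof -
      have "?s (f x) = f x" "?s (f y) = f y" using that assms(5) f(2) by auto
      then show ?thesis using f(1) that unfolding emb_def by auto
    qed
    then show "f \<in> ?G'" using f(1) unfolding emb_def by blast
  qed
  \<comment> \<open>The cloning map undoes the rerouting \<open>t\<close>; this gives the
    injectivity of \<open>t f\<close>, the edge condition for \<open>t f\<close> and the injectivity
    of \<open>t\<close>.\<close>
  have s: "?s (t f x) = f x" if "f \<in> ?T2" "x \<in> A" for f x
    using that by (auto simp: t_def)
  have T2: "t ` ?T2 \<subseteq> ?G'"
  proof (rule image_subsetI)
    fix f assume f2: "f \<in> ?T2"
    then have f: "f \<in> ?G" by blast
    have "t f \<in> A \<rightarrow>\<^sub>E V" using f assms(4) by (auto simp: t_def emb_def)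
    moreover have "inj_on (t f) A"
    proof (rule inj_onI)
      fix x y assume "x \<in> A" "y \<in> A" "t f x = t f y"
      then have "f x = f y" using s[OF f2] by metis
      then show "x = y" using f \<open>x \<in> A\<close> \<open>y \<in> A\<close> by (auto simp: emb_def inj_on_def)
    qed
    moreover have "E (?s (t f x)) (?s (t f y))" if "(x, y) \<in> P" for x y
    proof -
      have "x \<in> A" "y \<in> A" using that assms(5) by auto
      then show ?thesis using f that s[OF f2] unfolding emb_def by auto
    qed
    ultimately show "t f \<in> ?G'" unfolding emb_def by blast
  qed
  have inj: "inj_on t ?T2"
  proof (rule inj_onI)
    fix f f' assume *: "f \<in> ?T2" "f' \<in> ?T2" "t f = t f'"
    have "f x = f' x" if "x \<in> A" for x using s[OF *(1) that] s[OF *(2) that] *(3) by metis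
    then show "f = f'" using * by (intro PiE_ext[of f A "\<lambda>_. V"]) (auto simp: emb_def)
  qed
  have disj: "?T1 \<inter> t ` ?T2 = {}"
  proof -
    have "v \<in> t f ` A" if "f \<in> ?T2" for f
      using that by (auto simp: t_def image_iff)
    then show ?thesis by auto
  qed
  have "card ?T1 + card ?T2 = card (?T1 \<union> t ` ?T2)"
    using fin disj inj by (subst card_Un_disjoint) (auto simp: card_image)
  also have "\<dots> \<le> card ?G'" using fin T1 T2 by (intro card_mono) auto
  finally have "card ?T1 + card ?T2 \<le> card ?G'" .
  moreover have "card ?G = card ?T1 + card {f \<in> ?G. v \<in> f ` A}"
    using fin by (subst card_Un_disjoint[symmetric]) (auto intro: arg_cong[where f = card])
  moreover have "card {f \<in> ?G. u \<in> f ` A} = card ?T2 + card {f \<in> ?G. u \<in> f ` A \<and> v \<in> f ` A}"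
    using fin by (subst card_Un_disjoint[symmetric]) (auto intro: arg_cong[where f = card])
  ultimately show ?thesis by linarith
qed

section \<open>Extremal graphs are multipartite\<close>

text \<open>The set \<open>P\<close> contains each edge of the counted graph in exactly one orientation.\<close>

locale pattern =
  fixes A :: "'a set" and P :: "('a \<times> 'a) set" and V :: "'b set"
  assumes finA: "finite A" and finV: "finite V" and P_sub: "P \<subseteq> A \<times> A"
    and P_asym: "(x, y) \<in> P \<Longrightarrow> (y, x) \<notin> P"
    and P_ne: "P \<noteq> {}"
    and big: "2 * card A \<le> card V"
begin

section \<open>Counts for a fixed pattern\<close>

text \<open>The number of injections of \<open>A\<close> into \<open>V\<close> with \<open>j\<close>
  values prescribed.\<close>

definition N :: "nat \<Rightarrow> nat" where
  "N j = (\<Prod>i = j..<card A. card V - i)"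

definition pinj2 :: "'a \<Rightarrow> 'a \<Rightarrow> 'b \<Rightarrow> 'b \<Rightarrow> ('a \<Rightarrow> 'b) set" where
  "pinj2 x y u v = pinj A V {x, y} (\<lambda>z. if z = x then u else v)"

lemma finP: "finite P"
  using P_sub finA by (meson finite_SigmaI finite_subset)

lemma P_edge: "(x, y) \<in> P \<Longrightarrow> x \<in> A \<and> y \<in> A \<and> x \<noteq> y"
  using P_sub P_asym by blast

lemma card_P_le: "card P \<le> card A * card A"
  using card_mono[OF _ P_sub] finA by (simp add: card_cartesian_product)

lemma card_A_ge: "card A \<ge> 2"
proof -
  obtain x y where "(x, y) \<in> P" using P_ne by auto
  then have "{x, y} \<subseteq> A" "x \<noteq> y" using P_edge by auto
  then show ?thesis using card_mono[OF finA, of "{x, y}"] by simp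
qed

lemma N_pos: "N j > 0"
  unfolding N_def using big by (auto intro!: prod_pos)

lemma N_0: "N 0 = card V * N 1" and N_1: "N 1 = (card V - 1) * N 2"
proof -
  have "{0..<card A} = insert 0 {1..<card A}" "{1..<card A} = insert 1 {2..<card A}"
    using card_A_ge by auto
  then show "N 0 = card V * N 1" "N 1 = (card V - 1) * N 2" unfolding N_def by simp_all
qed

lemma card_pinj1: "x \<in> A \<Longrightarrow> u \<in> V \<Longrightarrow> card (pinj A V {x} (\<lambda>_. u)) = N 1"
  using card_pinj[OF finV finA, of "{x}" "\<lambda>_. u"] by (simp add: N_def)

lemma card_pinj2:
  assumes "x \<in> A" "y \<in> A" "x \<noteq> y" "u \<in> V" "v \<in> V" "u \<noteq> v"
  shows "card (pinj2 x y u v) = N 2"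
  using card_pinj[OF finV finA, of "{x, y}" "\<lambda>z. if z = x then u else v"] assms
  by (simp add: N_def pinj2_def numeral_2_eq_2)

lemma mem_pinj2:
  assumes "x \<noteq> y"
  shows "f \<in> pinj2 x y u v \<longleftrightarrow> f \<in> A \<rightarrow>\<^sub>E V \<and> inj_on f A \<and> f x = u \<and> f y = v"
  using assms by (auto simp: pinj2_def pinj_def)

lemma finite_pinj2: "finite (pinj2 x y u v)"
  using finA finV by (simp add: pinj2_def finite_pinj)

text \<open>The union bound with nothing prescribed: almost all injections are embeddings when
  degrees in the complement are small.\<close>

lemma card_emb_ge:
  assumes sym: "\<And>u v. E u v \<Longrightarrow> E v u"
    and D: "\<And>u. u \<in> V \<Longrightarrow> card {v \<in> V. v \<noteq> u \<and> \<not> E u v} \<le> D"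
  shows "card V * N 0 \<le> card V * card (emb A P V E) + 2 * card P * D * N 0"
proof -
  have "card V * N 0 \<le> card V * card {f \<in> pinj A V {} undefined. \<forall>(z, w)\<in>P. E (f z) (f w)} + 2 * card P * D * N 0"
    using card_pinj_le_extensions[OF finV finA _ _ _ big P_sub _ sym D, of "{}" undefined]
      P_edge unfolding N_def by simp
  moreover have "{f \<in> pinj A V {} undefined. \<forall>(z, w)\<in>P. E (f z) (f w)} = emb A P V E"
    by (auto simp: pinj_def emb_def)
  ultimately show ?thesis by simp
qed

text \<open>The pair \<open>(x, y)\<close> is exempt from the edge condition, since it will be sent
  either to a missing pair or to a pair already known to be an edge.\<close>

lemma card_pinj2_extensions_ge:
  assumes sym: "\<And>u v. E u v \<Longrightarrow> E v u"
    and D: "\<And>u. u \<in> V \<Longrightarrow> card {v \<in> V. v \<noteq> u \<and> \<not> E u v} \<le> D"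
    and xy: "(x, y) \<in> P" and uv: "u \<in> V" "v \<in> V" "u \<noteq> v"
  shows "card V * N 2 \<le> card V * card {f \<in> pinj2 x y u v. \<forall>(z, w)\<in>P - {(x, y)}. E (f z) (f w)}
    + 2 * card P * D * N 2"
proof -
  note e = P_edge[OF xy]
  \<comment> \<open>The only other pair inside \<open>{x, y}\<close> would be \<open>(y, x)\<close>,
    which asymmetry of \<open>P\<close> excludes.\<close>
  have pr: "z \<noteq> w \<and> (z \<notin> {x, y} \<or> w \<notin> {x, y})" if "(z, w) \<in> P - {(x, y)}" for z w
    using that P_edge P_asym[OF xy] by auto
  have "card V * N 2 \<le> card V * card {f \<in> pinj2 x y u v. \<forall>(z, w)\<in>P - {(x, y)}. E (f z) (f w)}
    + 2 * card (P - {(x, y)}) * D * N 2"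
  proof -
    have 1: "P - {(x, y)} \<subseteq> A \<times> A" "{x, y} \<subseteq> A" and 2: "card {x, y} = 2"
      using P_sub e by auto
    have 3: "inj_on (\<lambda>z. if z = x then u else v) {x, y}" "(\<lambda>z. if z = x then u else v) ` {x, y} \<subseteq> V"
      using e uv by (auto simp: inj_on_def)
    show ?thesis
      using card_pinj_le_extensions[OF finV finA 1(2) 3 big 1(1) pr sym D]
      unfolding N_def pinj2_def 2 .
  qed
  moreover have "2 * card (P - {(x, y)}) * D * N 2 \<le> 2 * card P * D * N 2"
    using finP by (intro mult_right_mono mult_left_mono card_mono) auto
  ultimately show ?thesis by linarith
qed

text \<open>Each point of \<open>A\<close> is sent to \<open>v\<close> by \<open>N 1\<close>
  injections. For one fixed edge \<open>(x, y)\<close>, those with \<open>x\<close> at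
  \<open>v\<close> and \<open>y\<close> at a non-neighbour of \<open>v\<close> are no embeddings,
  which removes \<open>N 2\<close> injections for each non-neighbour.\<close>

lemma card_emb_through_le:
  assumes "v \<in> V"
  shows "card {f \<in> emb A P V E. v \<in> f ` A} + card {w \<in> V. w \<noteq> v \<and> \<not> E v w} * N 2 \<le> card A * N 1"
proof -
  obtain x y where xy: "(x, y) \<in> P" using P_ne by auto
  note e = P_edge[OF xy]
  let ?C = "{w \<in> V. w \<noteq> v \<and> \<not> E v w}"
  let ?p = "\<lambda>x. pinj A V {x} (\<lambda>_. v)"
  let ?U = "\<Union>w\<in>?C. pinj2 x y v w"
  have cU: "card ?U = card ?C * N 2"
  proof -
    have "card ?U = (\<Sum>w\<in>?C. card (pinj2 x y v w))"
      using finV finite_pinj2 e by (intro card_UN_disjoint) (auto simp: mem_pinj2)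
    also have "\<dots> = (\<Sum>w\<in>?C. N 2)"
      using e assms by (intro sum.cong) (auto simp: card_pinj2)
    finally show ?thesis by simp
  qed
  have sub: "?U \<subseteq> ?p x" using e by (auto simp: mem_pinj2) (auto simp: pinj_def)
  have "{f \<in> emb A P V E. v \<in> f ` A} \<subseteq> (?p x - ?U) \<union> (\<Union>z\<in>A - {x}. ?p z)"
  proof
    fix f assume "f \<in> {f \<in> emb A P V E. v \<in> f ` A}"
    then obtain z where f: "f \<in> emb A P V E" "z \<in> A" "v = f z" by blast
    have "E (f x) (f y)" using f(1) xy by (auto simp: emb_def)
    then have "z = x \<Longrightarrow> f \<notin> ?U" using f(3) e by (auto simp: mem_pinj2)
    moreover have "f \<in> ?p z" using f by (auto simp: emb_def pinj_def)
    ultimately show "f \<in> (?p x - ?U) \<union> (\<Union>z\<in>A - {x}. ?p z)" using f(2) by blast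
  qed
  then have "card {f \<in> emb A P V E. v \<in> f ` A} \<le> card ((?p x - ?U) \<union> (\<Union>z\<in>A - {x}. ?p z))"
    using finA finV by (intro card_mono) (auto intro: finite_pinj)
  also have "\<dots> \<le> card (?p x - ?U) + (\<Sum>z\<in>A - {x}. card (?p z))"
    using card_Un_le[of "?p x - ?U" "\<Union>z\<in>A - {x}. ?p z"] card_UN_le[of "A - {x}" ?p] finA
    by fastforce
  also have "card (?p x - ?U) = N 1 - card ?C * N 2"
    using sub finite_subset[OF sub] finA finV e assms cU card_pinj1[of x v]
    by (simp add: card_Diff_subset finite_pinj)
  also have "(\<Sum>z\<in>A - {x}. card (?p z)) = (card A - 1) * N 1"
    using assms e finA by (simp add: card_pinj1)
  finally have 1: "card {f \<in> emb A P V E. v \<in> f ` A} \<le> N 1 - card ?C * N 2 + (card A - 1) * N 1" .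
  have "card ?C * N 2 \<le> N 1"
    using card_mono[OF _ sub] finA finV cU card_pinj1[of x v] e assms by (simp add: finite_pinj)
  moreover have "card A * N 1 = N 1 + (card A - 1) * N 1"
    using card_A_ge by (cases "card A") auto
  ultimately show ?thesis using 1 by linarith
qed

lemma card_emb_through_both_le:
  assumes "u \<in> V" "v \<in> V" "u \<noteq> v"
  shows "card {f \<in> emb A P V E. u \<in> f ` A \<and> v \<in> f ` A} \<le> card A * card A * N 2"
proof -
  let ?I = "{(x, y) \<in> A \<times> A. x \<noteq> y}"
  have finI: "finite ?I" using finA by (auto intro: finite_subset[of _ "A \<times> A"])
  have "{f \<in> emb A P V E. u \<in> f ` A \<and> v \<in> f ` A} \<subseteq> (\<Union>(x, y)\<in>?I. pinj2 x y u v)"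
  proof
    fix f assume "f \<in> {f \<in> emb A P V E. u \<in> f ` A \<and> v \<in> f ` A}"
    then obtain x y where *: "f \<in> emb A P V E" "u = f x" "v = f y" "x \<in> A" "y \<in> A" by blast
    then have "x \<noteq> y" using assms(3) by auto
    moreover have "f \<in> pinj2 x y u v" using * \<open>x \<noteq> y\<close> by (auto simp: mem_pinj2 emb_def)
    ultimately show "f \<in> (\<Union>(x, y)\<in>?I. pinj2 x y u v)" using *(4,5) by auto
  qed
  then have "card {f \<in> emb A P V E. u \<in> f ` A \<and> v \<in> f ` A} \<le> card (\<Union>(x, y)\<in>?I. pinj2 x y u v)"
    using finI finite_pinj2 by (intro card_mono) auto
  also have "\<dots> \<le> (\<Sum>(x, y)\<in>?I. card (pinj2 x y u v))"
    using card_UN_le[OF finI, of "\<lambda>(x, y). pinj2 x y u v"] by (simp add: split_def)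
  also have "\<dots> = (\<Sum>p\<in>?I. N 2)"
    using assms by (intro sum.cong) (auto simp: card_pinj2)
  also have "\<dots> = card ?I * N 2" by simp
  also have "\<dots> \<le> card A * card A * N 2"
    using card_mono[of "A \<times> A" ?I] finA by (intro mult_right_mono) (auto simp: card_cartesian_product)
  finally show ?thesis .
qed

text \<open>Averaging: each embedding covers exactly \<open>card A\<close> vertices.\<close>

lemma ex_popular_vertex:
  assumes "V \<noteq> {}"
  shows "\<exists>u\<in>V. card A * card (emb A P V E) \<le> card V * card {f \<in> emb A P V E. u \<in> f ` A}"
proof (rule ccontr)
  assume "\<not> ?thesis"
  then have *: "card V * card {f \<in> emb A P V E. u \<in> f ` A} < card A * card (emb A P V E)" if "u \<in> V" for u
    using that by (auto simp: not_le)
  have "(\<Sum>u\<in>V. card {f \<in> emb A P V E. u \<in> f ` A}) = card A * card (emb A P V E)"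
  proof (rule sum_multicount)
    show "\<forall>f\<in>emb A P V E. card {u \<in> V. u \<in> f ` A} = card A"
    proof
      fix f assume "f \<in> emb A P V E"
      then have "{u \<in> V. u \<in> f ` A} = f ` A" "inj_on f A" by (auto simp: emb_def)
      then show "card {u \<in> V. u \<in> f ` A} = card A" by (simp add: card_image)
    qed
  qed (use finA finV finite_emb in auto)
  moreover have "(\<Sum>u\<in>V. card V * card {f \<in> emb A P V E. u \<in> f ` A}) < (\<Sum>u\<in>V. card A * card (emb A P V E))"
    using * assms finV by (intro sum_strict_mono) auto
  ultimately show False by (simp add: sum_distrib_left[symmetric])
qed

section \<open>Codegrees in an extremal graph\<close>

text \<open>Cloning a popular vertex \<open>u\<close> in place of \<open>v\<close> gains nothing, so
  \<open>v\<close> lies in almost as many embeddings as \<open>u\<close>. By \<open>many\<close>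
  nearly all injections are embeddings, so this number is close to \<open>card A * N 1\<close>,
  while every non-neighbour of \<open>v\<close> lowers it by \<open>N 2\<close>.\<close>

lemma extremal_codegree_le:
  assumes sym: "\<And>u v. E u v \<Longrightarrow> E v u" and irr: "\<And>v. \<not> E v v"
    and free: "\<not> contains_clique V E m"
    and max: "\<And>E'. (\<And>u v. E' u v \<Longrightarrow> E' v u) \<Longrightarrow> (\<And>v. \<not> E' v v) \<Longrightarrow> \<not> contains_clique V E' m
      \<Longrightarrow> card (emb A P V E') \<le> card (emb A P V E)"
    and many: "r * N 0 \<le> r * card (emb A P V E) + 2 * card P * N 0"
    and r: "r \<le> card V" and v: "v \<in> V"
  shows "r * card {w \<in> V. w \<noteq> v \<and> \<not> E v w} \<le> 3 * card A ^ 3 * card V"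
proof -
  define k n p where "k = card A" and "n = card V" and "p = card P"
  let ?G = "emb A P V E"
  have n: "n > 0" using v finV by (auto simp: n_def card_gt_0_iff)
  obtain u where u: "u \<in> V" "k * card ?G \<le> n * card {f \<in> ?G. u \<in> f ` A}"
    using ex_popular_vertex[of E] v unfolding k_def n_def by blast
  define Nu Nv C where "Nu = card {f \<in> ?G. u \<in> f ` A}" and "Nv = card {f \<in> ?G. v \<in> f ` A}"
    and "C = card {w \<in> V. w \<noteq> v \<and> \<not> E v w}"
  have "Nu \<le> Nv + k * k * N 2"
  proof (cases "u = v")
    case False
    have "card (emb A P V (\<lambda>a b. E ((id(v := u)) a) ((id(v := u)) b))) \<le> card ?G"
    proof (rule max)
      show "\<not> contains_clique V (\<lambda>a b. E ((id(v := u)) a) ((id(v := u)) b)) m"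
        by (rule clique_free_pullback[where E = E and W = V]) (use irr u(1) free in auto)
    qed (use sym irr in blast)+
    then show ?thesis
      using clone_emb[OF finA finV u(1) v P_sub, of E] card_emb_through_both_le[OF u(1) v False, of E]
      unfolding Nu_def Nv_def k_def by linarith
  qed (simp add: Nu_def Nv_def)
  moreover have "Nv + C * N 2 \<le> k * N 1"
    using card_emb_through_le[OF v, of E] unfolding Nv_def C_def k_def .
  ultimately have 1: "Nu + C * N 2 \<le> k * N 1 + k * k * N 2" by linarith
  have "k * (r * N 0) \<le> r * (k * card ?G) + k * (2 * p * N 0)"
    using mult_le_mono2[OF many, of k] by (simp add: p_def algebra_simps)
  also have "\<dots> \<le> r * (n * Nu) + k * (2 * p * N 0)" using u(2) by (simp add: Nu_def)
  finally have "n * (k * r * N 1) \<le> n * (r * Nu + 2 * k * p * N 1)"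
    by (simp add: N_0 n_def algebra_simps)
  then have 2: "k * r * N 1 \<le> r * Nu + 2 * k * p * N 1" using n by simp
  have "r * Nu + r * C * N 2 \<le> k * r * N 1 + r * k * k * N 2"
    using mult_le_mono2[OF 1, of r] by (simp add: algebra_simps)
  with 2 have "r * C * N 2 \<le> 2 * k * p * N 1 + r * k * k * N 2" by linarith
  \<comment> \<open>By \<open>r <= n\<close> and \<open>N 1 <= n * N 2\<close>, both error terms
    become multiples of \<open>n * N 2\<close>.\<close>
  also have "\<dots> \<le> 2 * k * p * (n * N 2) + n * k * k * N 2"
    using r N_1 by (intro add_mono mult_right_mono mult_left_mono) (auto simp: n_def)
  finally have "(r * C) * N 2 \<le> (2 * k * p * n + n * k * k) * N 2" by (simp add: algebra_simps)
  then have "r * C \<le> 2 * k * p * n + n * k * k" using N_pos[of 2] by simp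
  \<comment> \<open>Here \<open>p <= k * k\<close>, and the second term is raised from
    \<open>k * k\<close> to the cube, so that the constants add up to 3.\<close>
  also have "\<dots> \<le> 2 * k * (k * k) * n + n * k * k * k"
    using card_P_le card_A_ge by (intro add_mono mult_right_mono mult_left_mono) (auto simp: p_def k_def)
  also have "\<dots> = 3 * k ^ 3 * n" by (simp add: power3_eq_cube algebra_simps)
  finally show ?thesis by (simp add: C_def k_def n_def)
qed

section \<open>Passing to the complete multipartite graph\<close>

text \<open>The comparison goes through the common subgraph \<open>E0\<close>. Deleting the
  monochromatic edges loses at most \<open>N 2\<close> embeddings per edge of the pattern and
  ordered pair in \<open>?B\<close>; adding the missing bichromatic pairs gains at least
  \<open>N 2 / 2\<close> per edge and pair in \<open>?M\<close>. The factor 2 in \<open>BM\<close>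
  balances this.\<close>

lemma card_emb_le_multipartite:
  fixes col :: "'b \<Rightarrow> 'c"
  assumes sym: "\<And>u v. E u v \<Longrightarrow> E v u"
    and D: "\<And>u. u \<in> V \<Longrightarrow> card {v \<in> V. v \<noteq> u \<and> \<not> E u v} \<le> D"
    and part: "\<And>u. u \<in> V \<Longrightarrow> card {v \<in> V. v \<noteq> u \<and> col v = col u} \<le> D"
    and small: "8 * card P * D \<le> card V"
    and BM: "2 * card (SIGMA u:V. {v \<in> V. E u v \<and> col v = col u}) \<le> card (SIGMA u:V. {v \<in> V. \<not> E u v \<and> col v \<noteq> col u})"
    and irr: "\<And>v. \<not> E v v"
  shows "card (emb A P V E) \<le> card (emb A P V (\<lambda>u v. col u \<noteq> col v))"
proof -
  define E0 where "E0 = (\<lambda>u v. E u v \<and> col u \<noteq> col v)"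
  let ?B = "SIGMA u:V. {v \<in> V. E u v \<and> col v = col u}"
  let ?M = "SIGMA u:V. {v \<in> V. \<not> E u v \<and> col v \<noteq> col u}"
  have finBM: "finite ?B" "finite ?M" using finV by auto
  have sym0: "E0 u v \<Longrightarrow> E0 v u" for u v using sym by (auto simp: E0_def)
  have D0: "card {v \<in> V. v \<noteq> u \<and> \<not> E0 u v} \<le> 2 * D" if "u \<in> V" for u
  proof -
    have "{v \<in> V. v \<noteq> u \<and> \<not> E0 u v} \<subseteq> {v \<in> V. v \<noteq> u \<and> \<not> E u v} \<union> {v \<in> V. v \<noteq> u \<and> col v = col u}"
      by (auto simp: E0_def)
    then have "card {v \<in> V. v \<noteq> u \<and> \<not> E0 u v}
      \<le> card ({v \<in> V. v \<noteq> u \<and> \<not> E u v} \<union> {v \<in> V. v \<noteq> u \<and> col v = col u})"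
      using finV by (intro card_mono) auto
    also have "\<dots> \<le> 2 * D" using card_Un_le D[OF that] part[OF that] by (smt (verit) add_mono le_trans mult_2)
    finally show ?thesis .
  qed
  define T where "T = (\<lambda>((x, y), (u, v)). pinj2 x y u v)"
  \<comment> \<open>In \<open>S\<close> all edges except \<open>(x, y)\<close> must land in
    \<open>E0\<close>. This is what keeps the sets for different indices disjoint.\<close>
  define S where "S = (\<lambda>((x, y), (u, v)). {f \<in> pinj2 x y u v. \<forall>(z, w)\<in>P - {(x, y)}. E0 (f z) (f w)})"
  have "emb A P V E \<subseteq> emb A P V E0 \<union> (\<Union>q\<in>P \<times> ?B. T q)"
  proof
    fix f assume f: "f \<in> emb A P V E"
    show "f \<in> emb A P V E0 \<union> (\<Union>q\<in>P \<times> ?B. T q)"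
    proof (cases "f \<in> emb A P V E0")
      case False
      then obtain x y where xy: "(x, y) \<in> P" "\<not> E0 (f x) (f y)" using f by (auto simp: emb_def)
      then have "E (f x) (f y)" "col (f y) = col (f x)" using f by (auto simp: emb_def E0_def)
      moreover have "f x \<in> V" "f y \<in> V" using f P_edge[OF xy(1)] by (auto simp: emb_def)
      moreover have "f \<in> T ((x, y), (f x, f y))"
        using f P_edge[OF xy(1)] by (auto simp: T_def mem_pinj2 emb_def)
      ultimately show ?thesis using xy(1) by blast
    qed simp
  qed
  then have "card (emb A P V E) \<le> card (emb A P V E0 \<union> (\<Union>q\<in>P \<times> ?B. T q))"
    using finP finBM finA finV by (intro card_mono) (auto simp: T_def intro: finite_pinj2 finite_emb)
  also have "\<dots> \<le> card (emb A P V E0) + (\<Sum>q\<in>P \<times> ?B. card (T q))"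
    using card_Un_le[of "emb A P V E0" "\<Union>q\<in>P \<times> ?B. T q"] card_UN_le[of "P \<times> ?B" T] finP finBM
    by fastforce
  also have "(\<Sum>q\<in>P \<times> ?B. card (T q)) = (\<Sum>q\<in>P \<times> ?B. N 2)"
  proof (rule sum.cong[OF refl], clarify)
    fix x y u v assume "(x, y) \<in> P" "u \<in> V" "v \<in> V" "E u v"
    then show "card (T ((x, y), (u, v))) = N 2"
      unfolding T_def using P_edge irr by (auto intro!: card_pinj2)
  qed
  also have "\<dots> = card P * card ?B * N 2" by (simp add: card_cartesian_product)
  finally have 1: "card (emb A P V E) \<le> card (emb A P V E0) + card P * card ?B * N 2" .
  \<comment> \<open>Complement degrees in \<open>E0\<close> are at most \<open>2 * D\<close>, so the
    union bound loses a fraction \<open>4 * card P * D / card V\<close>, at most one half by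
    \<open>small\<close>.\<close>
  have cS: "N 2 \<le> 2 * card (S q)" if q: "q \<in> P \<times> ?M" for q
  proof -
    obtain x y u v where q': "q = ((x, y), (u, v))" by (metis surj_pair)
    have *: "(x, y) \<in> P" "u \<in> V" "v \<in> V" "u \<noteq> v" using q q' by auto
    have "card V * N 2 \<le> card V * card (S q) + 2 * card P * (2 * D) * N 2"
      unfolding S_def q' using card_pinj2_extensions_ge[OF sym0 D0 *] by simp
    then have "2 * (card V * N 2) \<le> 2 * (card V * card (S q)) + 8 * card P * D * N 2" by linarith
    also have "\<dots> \<le> 2 * (card V * card (S q)) + card V * N 2"
      using small by (intro add_mono mult_right_mono) auto
    finally have "card V * N 2 \<le> card V * (2 * card (S q))" by simp
    moreover have "card V > 0" using *(2) finV by (auto simp: card_gt_0_iff)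
    ultimately show ?thesis by simp
  qed
  have Sx: "f x = u \<and> f y = v \<and> f \<in> A \<rightarrow>\<^sub>E V \<and> inj_on f A \<and> (\<forall>(z, w)\<in>P - {(x, y)}. E0 (f z) (f w))"
    if "f \<in> S ((x, y), (u, v))" "(x, y) \<in> P" for f x y u v
    using that P_edge by (auto simp: S_def mem_pinj2)
  have E0M: "\<not> E0 u v" if "(u, v) \<in> ?M" for u v using that by (auto simp: E0_def)
  \<comment> \<open>For \<open>f\<close> in \<open>S q\<close>, the pair \<open>(x, y)\<close> is
    the only one that misses \<open>E0\<close>; so \<open>f\<close> determines it, and then
    \<open>u\<close> and \<open>v\<close> as its values.\<close>
  have disj: "S q \<inter> S q' = {}" if q: "q \<in> P \<times> ?M" "q' \<in> P \<times> ?M" "q \<noteq> q'" for q q'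
  proof (rule ccontr)
    assume "S q \<inter> S q' \<noteq> {}"
    then obtain f where f: "f \<in> S q" "f \<in> S q'" by blast
    obtain x y u v x' y' u' v' where qq: "q = ((x, y), (u, v))" "q' = ((x', y'), (u', v'))"
      by (metis surj_pair)
    have P2: "(x, y) \<in> P" "(x', y') \<in> P" "(u, v) \<in> ?M" "(u', v') \<in> ?M" using q qq by auto
    note f1 = Sx[OF f(1)[unfolded qq] P2(1)] and f2 = Sx[OF f(2)[unfolded qq] P2(2)]
    have "(x, y) = (x', y')"
    proof (rule ccontr)
      assume "(x, y) \<noteq> (x', y')"
      then have "E0 (f x') (f y')" using f1 P2(2) by blast
      then show False using f2 E0M[OF P2(4)] by simp
    qed
    then have "q = q'" using f1 f2 qq by simp
    with q show False by simp
  qed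
  have "emb A P V E0 \<union> (\<Union>q\<in>P \<times> ?M. S q) \<subseteq> emb A P V (\<lambda>u v. col u \<noteq> col v)"
  proof (rule Un_least)
    show "emb A P V E0 \<subseteq> emb A P V (\<lambda>u v. col u \<noteq> col v)" by (auto simp: emb_def E0_def)
    show "(\<Union>q\<in>P \<times> ?M. S q) \<subseteq> emb A P V (\<lambda>u v. col u \<noteq> col v)"
    proof clarify
      fix f x y u v assume *: "f \<in> S ((x, y), (u, v))" "(x, y) \<in> P" "col v \<noteq> col u"
      note f = Sx[OF *(1,2)]
      have "col (f z) \<noteq> col (f w)" if "(z, w) \<in> P" for z w
        using f that *(3) by (cases "(z, w) = (x, y)") (auto simp: E0_def)
      then show "f \<in> emb A P V (\<lambda>u v. col u \<noteq> col v)" using f by (auto simp: emb_def)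
    qed
  qed
  then have "card (emb A P V E0 \<union> (\<Union>q\<in>P \<times> ?M. S q)) \<le> card (emb A P V (\<lambda>u v. col u \<noteq> col v))"
    using finA finV by (intro card_mono finite_emb)
  moreover have "emb A P V E0 \<inter> (\<Union>q\<in>P \<times> ?M. S q) = {}"
  proof (rule ccontr)
    assume "emb A P V E0 \<inter> (\<Union>q\<in>P \<times> ?M. S q) \<noteq> {}"
    then obtain f x y u v where *: "f \<in> emb A P V E0" "(x, y) \<in> P" "(u, v) \<in> ?M" "f \<in> S ((x, y), (u, v))"
      by fast
    then have "E0 (f x) (f y)" by (auto simp: emb_def)
    then show False using Sx[OF *(4,2)] E0M[OF *(3)] by simp
  qed
  moreover have finS: "finite (S q)" for q
    by (rule finite_subset[of _ "T q"]) (auto simp: S_def T_def finite_pinj2 split: prod.splits)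
  ultimately have 2: "card (emb A P V E0) + card (\<Union>q\<in>P \<times> ?M. S q) \<le> card (emb A P V (\<lambda>u v. col u \<noteq> col v))"
    using finP finBM finA finV by (subst (asm) card_Un_disjoint) (auto intro: finite_emb)
  have "card P * card ?M * N 2 = (\<Sum>q\<in>P \<times> ?M. N 2)" by (simp add: card_cartesian_product)
  also have "\<dots> \<le> (\<Sum>q\<in>P \<times> ?M. 2 * card (S q))" by (rule sum_mono) (rule cS)
  also have "\<dots> = 2 * (\<Sum>q\<in>P \<times> ?M. card (S q))" by (simp add: sum_distrib_left)
  also have "(\<Sum>q\<in>P \<times> ?M. card (S q)) = card (\<Union>q\<in>P \<times> ?M. S q)"
    using finP finBM finS disj by (intro card_UN_disjoint[symmetric]) auto
  finally have 3: "card P * card ?M * N 2 \<le> 2 * card (\<Union>q\<in>P \<times> ?M. S q)" .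
  have "2 * (card P * card ?B * N 2) = card P * (2 * card ?B) * N 2" by simp
  also have "\<dots> \<le> card P * card ?M * N 2" using BM by (intro mult_right_mono mult_left_mono) auto
  finally show ?thesis using 1 2 3 by linarith
qed

end

section \<open>Balancing the parts\<close>

text \<open>Composition with \<open>h\<close> turns embeddings into embeddings injectively. It is
  used to rename vertices, to swap colour classes and to enter the Turan graph.\<close>

lemma card_emb_mono_map:
  assumes "finite A" "finite W" "P \<subseteq> A \<times> A" "inj_on h V" "h ` V \<subseteq> W"
    and E: "\<And>u v. u \<in> V \<Longrightarrow> v \<in> V \<Longrightarrow> E u v \<Longrightarrow> F (h u) (h v)"
  shows "card (emb A P V E) \<le> card (emb A P W F)"
proof (rule card_inj_on_le[where f = "\<lambda>f. restrict (h \<circ> f) A"])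
  show "inj_on (\<lambda>f. restrict (h \<circ> f) A) (emb A P V E)"
  proof (rule inj_onI)
    fix f g assume *: "f \<in> emb A P V E" "g \<in> emb A P V E" "restrict (h \<circ> f) A = restrict (h \<circ> g) A"
    have "f x = g x" if x: "x \<in> A" for x
    proof -
      have "h (f x) = h (g x)" using fun_cong[OF *(3), of x] x by simp
      moreover have "f x \<in> V" "g x \<in> V" using * x by (auto simp: emb_def)
      ultimately show ?thesis using assms(4) by (auto dest: inj_onD)
    qed
    then show "f = g" using * by (intro PiE_ext[of f A "\<lambda>_. V"]) (auto simp: emb_def)
  qed
  show "(\<lambda>f. restrict (h \<circ> f) A) ` emb A P V E \<subseteq> emb A P W F"
  proof (rule image_subsetI)
    fix f assume f: "f \<in> emb A P V E"
    then have fV: "f ` A \<subseteq> V" by (auto simp: emb_def)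
    have "restrict (h \<circ> f) A \<in> A \<rightarrow>\<^sub>E W" using fV assms(5) by (auto simp: image_subset_iff)
    moreover have "inj_on (h \<circ> f) A"
      using f fV assms(4) by (intro comp_inj_on) (auto simp: emb_def intro: inj_on_subset)
    then have "inj_on (restrict (h \<circ> f) A) A" by (simp add: inj_on_restrict_eq)
    moreover have "F (restrict (h \<circ> f) A x) (restrict (h \<circ> f) A y)" if "(x, y) \<in> P" for x y
    proof -
      have "x \<in> A" "y \<in> A" using that assms(3) by auto
      moreover have "E (f x) (f y)" using f that by (auto simp: emb_def)
      ultimately show ?thesis using E[of "f x" "f y"] fV by auto
    qed
    ultimately show "restrict (h \<circ> f) A \<in> emb A P W F" unfolding emb_def by blast
  qed
qed (use assms in \<open>simp add: finite_emb\<close>)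

context pattern
begin

text \<open>For embeddings destroyed by moving \<open>v\<close> into the class \<open>B\<close>:
  choose the edge at \<open>v\<close>, its other image in \<open>B\<close> and a third point
  \<open>z\<close> with image in \<open>R\<close>. Confining \<open>z\<close> to \<open>R\<close>
  costs a factor \<open>2 * card R / card V\<close>. The factor \<open>card R\<close> makes the loss
  comparable with the gain below.\<close>

lemma card_emb_lost_le:
  assumes "v \<in> V" "B \<subseteq> V" "R \<subseteq> V" "v \<notin> B" "v \<notin> R" "B \<inter> R = {}"
    and Q: "Q \<subseteq> A \<times> A" "\<And>x y. (x, y) \<in> Q \<Longrightarrow> x \<noteq> y"
    and L: "\<And>f. f \<in> L \<Longrightarrow> f \<in> A \<rightarrow>\<^sub>E V \<and> inj_on f A \<and> f ` A \<inter> R \<noteq> {} \<and> (\<exists>(x, y)\<in>Q. f x = v \<and> f y \<in> B)"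
  shows "card V * card L \<le> 2 * card A ^ 3 * card B * card R * N 2"
proof -
  define I where "I = {((x, y), u, z) \<in> Q \<times> B \<times> A. z \<noteq> x \<and> z \<noteq> y}"
  define T where "T = (\<lambda>((x, y), u, z). {f \<in> pinj2 x y v u. f z \<in> R})"
  have fin: "finite Q" "finite B" "finite R"
    using Q(1) finA finV assms(2,3) finite_subset[of Q "A \<times> A"] by (auto intro: finite_subset)
  have I: "I \<subseteq> Q \<times> B \<times> A" "finite I"
    using fin finA finite_subset[of I "Q \<times> B \<times> A"] by (auto simp: I_def)
  have cT: "card V * card (T q) \<le> 2 * card R * N 2" if q: "q \<in> I" for q
  proof -
    obtain x y u z where q': "q = ((x, y), u, z)" by (metis surj_pair)
    have *: "x \<in> A" "y \<in> A" "x \<noteq> y" "u \<in> B" "z \<in> A" "z \<noteq> x" "z \<noteq> y"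
      using q q' Q by (auto simp: I_def)
    have 1: "{x, y} \<subseteq> A" and 2: "card {x, y} = 2" using * by auto
    have uv: "u \<in> V" "u \<noteq> v" using * assms by auto
    have 3: "inj_on (\<lambda>z. if z = x then v else u) {x, y}" "(\<lambda>z. if z = x then v else u) ` {x, y} \<subseteq> V"
      using * uv assms(1) by (auto simp: inj_on_def)
    have "card V * card (T q) \<le> 2 * card R * (\<Prod>i = card {x, y}..<card A. card V - i)"
      by (rule card_pinj_restricted_le[OF finV finA 1 3, where w = z and R = "\<lambda>_. R"])
        (use * big fin in \<open>auto simp: q' T_def pinj2_def\<close>)
    then show ?thesis unfolding 2 N_def .
  qed
  have "L \<subseteq> (\<Union>q\<in>I. T q)"
  proof
    fix f assume f: "f \<in> L"
    from L[OF f] obtain x y where xy: "(x, y) \<in> Q" "f x = v" "f y \<in> B" by blast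
    from L[OF f] obtain z where z: "z \<in> A" "f z \<in> R" by blast
    have "z \<noteq> x" "z \<noteq> y" using z xy assms by auto
    then have "((x, y), f y, z) \<in> I" using xy z by (auto simp: I_def)
    moreover have "f \<in> T ((x, y), f y, z)"
      using L[OF f] xy z Q(2)[OF xy(1)] by (auto simp: T_def mem_pinj2)
    ultimately show "f \<in> (\<Union>q\<in>I. T q)" by blast
  qed
  moreover have "finite (T q)" for q
    by (rule finite_subset[of _ "pinj2 (fst (fst q)) (snd (fst q)) v (fst (snd q))"])
      (auto simp: T_def finite_pinj2)
  ultimately have "card L \<le> card (\<Union>q\<in>I. T q)" using I by (intro card_mono) auto
  also have "\<dots> \<le> (\<Sum>q\<in>I. card (T q))" using I by (intro card_UN_le)
  finally have "card V * card L \<le> (\<Sum>q\<in>I. card V * card (T q))"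
    unfolding sum_distrib_left[symmetric] by (rule mult_le_mono2)
  also have "\<dots> \<le> (\<Sum>q\<in>I. 2 * card R * N 2)" by (rule sum_mono) (rule cT)
  also have "\<dots> = card I * (2 * card R * N 2)" by simp
  also have "\<dots> \<le> (card A * card A * (card B * card A)) * (2 * card R * N 2)"
  proof (rule mult_right_mono)
    have "card I \<le> card (Q \<times> B \<times> A)" using I fin finA by (intro card_mono) auto
    also have "\<dots> = card Q * (card B * card A)" by (simp add: card_cartesian_product)
    also have "\<dots> \<le> (card A * card A) * (card B * card A)"
      using card_mono[OF _ Q(1)] finA by (intro mult_right_mono) (auto simp: card_cartesian_product)
    finally show "card I \<le> card A * card A * (card B * card A)" .
  qed simp
  finally show ?thesis by (simp add: power3_eq_cube algebra_simps)
qed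

text \<open>For each \<open>w\<close> in \<open>R\<close>, sending \<open>(x, y)\<close> to the edge
  from \<open>v\<close> to \<open>w\<close> leaves almost all \<open>N 2\<close> completions valid,
  and different \<open>w\<close> give different maps.\<close>

lemma card_emb_gained_ge:
  assumes sym: "\<And>u v. E u v \<Longrightarrow> E v u"
    and D: "\<And>u. u \<in> V \<Longrightarrow> card {v \<in> V. v \<noteq> u \<and> \<not> E u v} \<le> D"
    and v: "v \<in> V" "R \<subseteq> V" "v \<notin> R" and vR: "\<And>w. w \<in> R \<Longrightarrow> E v w" and xy: "(x, y) \<in> P"
  shows "card R * card V * N 2
    \<le> card V * card {f \<in> emb A P V E. f x = v \<and> f y \<in> R} + 2 * card P * D * card R * N 2"
proof -
  note e = P_edge[OF xy]
  define S where "S = (\<lambda>w. {f \<in> pinj2 x y v w. \<forall>(z, w)\<in>P - {(x, y)}. E (f z) (f w)})"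
  have finR: "finite R" using v(2) finV finite_subset by blast
  have finS: "finite (S w)" for w by (simp add: S_def finite_pinj2)
  have "(\<Sum>w\<in>R. card V * N 2) \<le> (\<Sum>w\<in>R. card V * card (S w) + 2 * card P * D * N 2)"
    unfolding S_def using v by (intro sum_mono card_pinj2_extensions_ge[OF sym D xy]) auto
  also have "\<dots> = card V * (\<Sum>w\<in>R. card (S w)) + 2 * card P * D * card R * N 2"
    by (simp add: sum.distrib sum_distrib_left)
  also have "(\<Sum>w\<in>R. card (S w)) = card (\<Union>w\<in>R. S w)"
    using finR finS e by (intro card_UN_disjoint[symmetric]) (auto simp: S_def mem_pinj2)
  also have "\<dots> \<le> card {f \<in> emb A P V E. f x = v \<and> f y \<in> R}"
  proof (rule card_mono)
    show "(\<Union>w\<in>R. S w) \<subseteq> {f \<in> emb A P V E. f x = v \<and> f y \<in> R}"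
    proof
      fix f assume "f \<in> (\<Union>w\<in>R. S w)"
      then obtain w where w: "w \<in> R" "f \<in> S w" by blast
      then have f: "f \<in> A \<rightarrow>\<^sub>E V" "inj_on f A" "f x = v" "f y = w" "\<forall>(z, w)\<in>P - {(x, y)}. E (f z) (f w)"
        using e by (auto simp: S_def mem_pinj2)
      have "E (f z) (f w)" if "(z, w) \<in> P" for z w
        using f vR[OF w(1)] that by (cases "(z, w) = (x, y)") auto
      then show "f \<in> {f \<in> emb A P V E. f x = v \<and> f y \<in> R}" using f w by (auto simp: emb_def)
    qed
  qed (use finA finV in \<open>simp add: finite_emb\<close>)
  finally show ?thesis by (simp add: algebra_simps)
qed

text \<open>Moving \<open>v\<close> from its class to the smaller class \<open>j\<close> creates
  edges from \<open>v\<close> to its old class and destroys those to \<open>B\<close>. After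
  matching \<open>B\<close> with an equally large part \<open>A0\<close> of the old class, only the
  surplus \<open>R\<close> matters: the gain is about \<open>card R * N 2\<close>, and the loss is
  smaller because \<open>B\<close> is small compared with \<open>V\<close>.\<close>

lemma unbalanced_improvable:
  fixes col :: "'b \<Rightarrow> 'c"
  assumes v: "v \<in> V" and j: "j \<noteq> col v"
    and part: "\<And>u. u \<in> V \<Longrightarrow> card {w \<in> V. w \<noteq> u \<and> col w = col u} \<le> D"
    and unb: "card {w \<in> V. col w = j} + 2 \<le> card {w \<in> V. col w = col v}"
    and small: "2 * card P * D + 2 * card A ^ 3 * D < card V"
  shows "card (emb A P V (\<lambda>a b. col a \<noteq> col b))
    < card (emb A P V (\<lambda>a b. (col(v := j)) a \<noteq> (col(v := j)) b))"
proof -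
  define c where "c = col(v := j)"
  define B where "B = {w \<in> V. col w = j}"
  define A' where "A' = {w \<in> V. w \<noteq> v \<and> col w = col v}"
  let ?K = "emb A P V (\<lambda>a b. col a \<noteq> col b)" and ?K' = "emb A P V (\<lambda>a b. c a \<noteq> c b)"
  have fin: "finite B" "finite A'" using finV by (auto simp: B_def A'_def)
  have "{w \<in> V. col w = col v} = insert v A'" using v by (auto simp: A'_def)
  then have cA': "card B + 1 \<le> card A'" using unb fin by (simp add: B_def A'_def)
  have bD: "card B \<le> D" using cA' part[OF v] unfolding A'_def by linarith
  obtain A0 where A0: "A0 \<subseteq> A'" "card A0 = card B" "finite A0"
    using obtain_subset_with_card_n[of "card B" A'] cA' by auto
  define R where "R = A' - A0"
  \<comment> \<open>The gap of 2 is used here: without \<open>v\<close>, the old class still has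
    more elements than \<open>B\<close>.\<close>
  have "R \<noteq> {}" using A0 cA' by (auto simp: R_def)
  have R: "R \<subseteq> V" "v \<notin> R" "B \<inter> R = {}" "A0 \<inter> B = {}" "v \<notin> B" "v \<notin> A0"
    using j A0 by (auto simp: R_def A'_def B_def)
  have "finite R" using fin by (simp add: R_def)
  with \<open>R \<noteq> {}\<close> have cR: "card R > 0" by (simp add: card_gt_0_iff)
  obtain h where h: "bij_betw h A0 B" using finite_same_card_bij[OF A0(3) fin(1) A0(2)] by blast
  define s where "s = (\<lambda>w. if w \<in> A0 then h w else if w \<in> B then inv_into A0 h w else w)"
  have sA: "s w \<in> B" if "w \<in> A0" for w using that h by (auto simp: s_def bij_betw_def)
  have sB: "s w \<in> A0" if "w \<in> B" for w
    using that h R(4) by (auto simp: s_def bij_betw_def inv_into_into)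
  have so: "s w = w" if "w \<notin> A0" "w \<notin> B" for w using that by (simp add: s_def)
  have ss: "s (s w) = w" for w
  proof -
    consider "w \<in> A0" | "w \<in> B" "w \<notin> A0" | "w \<notin> A0" "w \<notin> B" by blast
    then show ?thesis
    proof cases
      case 1
      then have "s w = h w" "h w \<in> B" "h w \<notin> A0" using sA[OF 1] R(4) by (auto simp: s_def)
      then show ?thesis using 1 h by (simp add: s_def bij_betw_def)
    next
      case 2
      then have "s w = inv_into A0 h w" by (simp add: s_def)
      moreover have "s w \<in> A0" using sB 2 by blast
      ultimately have "s w = inv_into A0 h w" "inv_into A0 h w \<in> A0" by simp_all
      then show ?thesis using 2 h by (simp add: s_def bij_betw_def f_inv_into_f)
    qed (simp add: so)
  qed
  have "inj s" using ss by (metis injI)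
  have colA0: "col w = col v" if "w \<in> A0" for w using that A0(1) by (auto simp: A'_def)
  have sV: "s w \<in> V - R" if "w \<in> V - R" for w
  proof -
    have "A0 \<subseteq> V - R" "B \<subseteq> V - R" using A0(1) R by (auto simp: A'_def B_def R_def)
    then show ?thesis using sA sB so that by (metis in_mono)
  qed
  \<comment> \<open>The map \<open>s\<close> fixes \<open>v\<close> and swaps \<open>A0\<close> with
    \<open>B\<close>. Outside \<open>R\<close> the old classes are \<open>A0\<close> with
    \<open>v\<close> and \<open>B\<close>, the new ones \<open>A0\<close> and \<open>B\<close> with
    \<open>v\<close>; so the colours \<open>col v\<close> and \<open>j\<close> trade places.\<close>
  have sc: "c (s w) = (if col w = col v then j else if col w = j then col v else col w)"
    if w: "w \<in> V - R" for w
  proof -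
    have ne: "x \<noteq> v" if "x \<in> A0 \<union> B" for x using that R by auto
    consider "w \<in> A0" | "w \<in> B" | "w = v" | "w \<notin> A0" "w \<notin> B" "w \<noteq> v" by blast
    then show ?thesis
    proof cases
      case 1
      then show ?thesis using sA[OF 1] ne colA0[OF 1] by (auto simp: c_def B_def)
    next
      case 2
      then show ?thesis using sB[OF 2] ne colA0 j by (auto simp: c_def B_def)
    next
      case 3
      then show ?thesis using so R by (simp add: c_def)
    next
      case 4
      then have "w \<notin> A'" using w by (auto simp: R_def)
      then show ?thesis using 4 w so by (auto simp: c_def A'_def B_def)
    qed
  qed
  \<comment> \<open>Outside \<open>R\<close> the two multipartite graphs are isomorphic via \<open>s\<close>, which swaps \<open>A0\<close> and \<open>B\<close>; so
    only embeddings meeting \<open>R\<close> matter.\<close>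
  have "card (emb A P (V - R) (\<lambda>a b. col a \<noteq> col b)) \<le> card (emb A P (V - R) (\<lambda>a b. c a \<noteq> c b))"
  proof (rule card_emb_mono_map[OF finA _ P_sub, where h = s])
    show "s ` (V - R) \<subseteq> V - R" using sV by blast
    show "c (s a) \<noteq> c (s b)" if "a \<in> V - R" "b \<in> V - R" "col a \<noteq> col b" for a b
      using sc[OF that(1)] sc[OF that(2)] that(3) by (simp split: if_splits)
  qed (use finV \<open>inj s\<close> in \<open>auto intro: inj_on_subset\<close>)
  moreover have avoid: "emb A P (V - R) E = {f \<in> emb A P V E. f ` A \<inter> R = {}}" for E
    by (auto simp: emb_def PiE_iff)
  ultimately have 1: "card {f \<in> ?K. f ` A \<inter> R = {}} \<le> card {f \<in> ?K'. f ` A \<inter> R = {}}" by simp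
  define L where "L = {f \<in> ?K - ?K'. f ` A \<inter> R \<noteq> {}}"
  \<comment> \<open>A destroyed edge may have \<open>v\<close> at either end, so both orientations
    are needed.\<close>
  define Q where "Q = P \<union> P\<inverse>"
  have "card V * card L \<le> 2 * card A ^ 3 * card B * card R * N 2"
  proof (rule card_emb_lost_le[where v = v and Q = Q])
    show "Q \<subseteq> A \<times> A" "\<And>x y. (x, y) \<in> Q \<Longrightarrow> x \<noteq> y" using P_sub P_edge by (auto simp: Q_def)
    show "f \<in> A \<rightarrow>\<^sub>E V \<and> inj_on f A \<and> f ` A \<inter> R \<noteq> {} \<and> (\<exists>(x, y)\<in>Q. f x = v \<and> f y \<in> B)" if f: "f \<in> L" for f
    proof -
      have fK: "f \<in> A \<rightarrow>\<^sub>E V" "inj_on f A" "f ` A \<inter> R \<noteq> {}" and fe: "\<forall>(x, y)\<in>P. col (f x) \<noteq> col (f y)"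
        using f by (auto simp: L_def emb_def)
      obtain x y where xy: "(x, y) \<in> P" "c (f x) = c (f y)"
        using f fK by (auto simp: L_def emb_def)
      have ne: "col (f x) \<noteq> col (f y)" using fe xy by auto
      have fV: "f x \<in> V" "f y \<in> V" using fK P_edge[OF xy(1)] by auto
      have "(f x = v \<and> f y \<in> B) \<or> (f y = v \<and> f x \<in> B)"
        using xy(2) ne fV by (auto simp: c_def B_def split: if_splits)
      then have "\<exists>(x, y)\<in>Q. f x = v \<and> f y \<in> B" using xy(1) by (auto simp: Q_def)
      then show ?thesis using fK by simp
    qed
  qed (use v R in \<open>auto simp: B_def\<close>)
  also have "\<dots> \<le> 2 * card A ^ 3 * D * card R * N 2"
    using bD by (intro mult_right_mono mult_left_mono) auto
  finally have 2: "card V * card L \<le> 2 * card A ^ 3 * D * card R * N 2" .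
  obtain x y where xy: "(x, y) \<in> P" using P_ne by auto
  define G where "G = {f \<in> ?K'. f x = v \<and> f y \<in> R}"
  have colR: "col w = col v" if "w \<in> R" for w using that by (auto simp: R_def A'_def)
  have 3: "card R * card V * N 2 \<le> card V * card G + 2 * card P * D * card R * N 2"
    unfolding G_def
  proof (rule card_emb_gained_ge[OF _ _ v R(1,2) _ xy])
    show "c v \<noteq> c w" if "w \<in> R" for w using colR[OF that] j R(2) that by (auto simp: c_def)
    \<comment> \<open>The class \<open>j\<close> has grown to \<open>insert v B\<close>, which
      without \<open>u\<close> has \<open>card B\<close> elements; no other class has grown.\<close>
    show "card {w \<in> V. w \<noteq> u \<and> \<not> c u \<noteq> c w} \<le> D" if u: "u \<in> V" for u
    proof (cases "c u = j")
      case True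
      then have "{w \<in> V. w \<noteq> u \<and> \<not> c u \<noteq> c w} \<subseteq> insert v B - {u}" "u \<in> insert v B"
        using u by (auto simp: c_def B_def split: if_splits)
      then have "card {w \<in> V. w \<noteq> u \<and> \<not> c u \<noteq> c w} \<le> card (insert v B - {u})"
        using fin by (intro card_mono) auto
      also have "\<dots> = card B" using \<open>u \<in> insert v B\<close> fin R(5) by simp
      finally show ?thesis using bD by simp
    next
      case False
      then have "{w \<in> V. w \<noteq> u \<and> \<not> c u \<noteq> c w} \<subseteq> {w \<in> V. w \<noteq> u \<and> col w = col u}"
        by (auto simp: c_def split: if_splits)
      then have "card {w \<in> V. w \<noteq> u \<and> \<not> c u \<noteq> c w} \<le> card {w \<in> V. w \<noteq> u \<and> col w = col u}"
        using finV by (intro card_mono) auto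
      then show ?thesis using part[OF u] by simp
    qed
  qed auto
  have GR: "f ` A \<inter> R \<noteq> {}" if "f \<in> G" for f using that P_edge[OF xy] by (auto simp: G_def)
  have GK: "f \<notin> ?K" if "f \<in> G" for f
  proof
    assume "f \<in> ?K"
    then have "col (f x) \<noteq> col (f y)" using xy by (auto simp: emb_def)
    then show False using that colR by (auto simp: G_def)
  qed
  have finK: "finite ?K" "finite ?K'" using finA finV by (auto intro: finite_emb)
  \<comment> \<open>Among embeddings meeting \<open>R\<close>, the common part \<open>?c\<close>
    cancels; \<open>L\<close> holds the lost ones and \<open>G\<close> some of the gained
    ones.\<close>
  let ?c = "{f \<in> ?K \<inter> ?K'. f ` A \<inter> R \<noteq> {}}"
  have "card ?K \<le> card ({f \<in> ?K. f ` A \<inter> R = {}} \<union> ?c \<union> L)"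
    using finK by (intro card_mono) (auto simp: L_def)
  then have 4: "card ?K \<le> card {f \<in> ?K. f ` A \<inter> R = {}} + card ?c + card L"
    using card_Un_le[of "{f \<in> ?K. f ` A \<inter> R = {}} \<union> ?c" L] card_Un_le[of "{f \<in> ?K. f ` A \<inter> R = {}}" ?c]
    by linarith
  have "card ({f \<in> ?K'. f ` A \<inter> R = {}} \<union> (?c \<union> G)) \<le> card ?K'"
    using finK by (intro card_mono) (auto simp: G_def)
  moreover have "card ({f \<in> ?K'. f ` A \<inter> R = {}} \<union> (?c \<union> G))
      = card {f \<in> ?K'. f ` A \<inter> R = {}} + card (?c \<union> G)"
    using finK GR by (intro card_Un_disjoint) (auto simp: G_def)
  moreover have "card (?c \<union> G) = card ?c + card G"
    using finK GK by (intro card_Un_disjoint) (auto simp: G_def)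
  ultimately have 5: "card {f \<in> ?K'. f ` A \<inter> R = {}} + card ?c + card G \<le> card ?K'" by linarith
  have "(2 * card P * D + 2 * card A ^ 3 * D) * (card R * N 2) < card V * (card R * N 2)"
    using small cR N_pos[of 2] by simp
  then have "card V * card L < card V * card G"
    using 2 3 by (simp only: algebra_simps)
  then have "card L < card G" by simp
  then show ?thesis using 1 4 5 unfolding c_def by linarith
qed

end

section \<open>Comparison with the Turan graph\<close>

lemma multipartite_clique_free:
  assumes "\<And>v. v \<in> V \<Longrightarrow> col v < r"
  shows "\<not> contains_clique V (\<lambda>u v. col u \<noteq> col v) (Suc r)"
proof
  assume "contains_clique V (\<lambda>u v. col u \<noteq> col v) (Suc r)"
  then obtain S where S: "S \<subseteq> V" "card S = Suc r" "\<forall>u\<in>S. \<forall>v\<in>S. u \<noteq> v \<longrightarrow> col u \<noteq> col v"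
    unfolding contains_clique_def by blast
  have "card S \<le> card {..<r}"
    using S assms by (intro card_inj_on_le[of col]) (auto simp: inj_on_def)
  then show False using S(2) by simp
qed

text \<open>Members of a residue class are told apart by their quotients, which lie in
  \<open>{0..(n - 1) div r}\<close>; leaving out \<open>u\<close> removes one quotient.\<close>

lemma card_cong_class_le:
  fixes n r u :: nat
  assumes "u < n" "r > 0"
  shows "card {v \<in> {0..<n}. v \<noteq> u \<and> v mod r = u mod r} \<le> (n - 1) div r"
proof -
  have "card {v \<in> {0..<n}. v \<noteq> u \<and> v mod r = u mod r} \<le> card ({0..(n - 1) div r} - {u div r})"
  proof (rule card_inj_on_le[where f = "\<lambda>v. v div r"])
    show "inj_on (\<lambda>v. v div r) {v \<in> {0..<n}. v \<noteq> u \<and> v mod r = u mod r}"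
      by (rule inj_onI) (metis (mono_tags, lifting) div_mult_mod_eq mem_Collect_eq)
    show "(\<lambda>v. v div r) ` {v \<in> {0..<n}. v \<noteq> u \<and> v mod r = u mod r} \<subseteq> {0..(n - 1) div r} - {u div r}"
    proof (rule image_subsetI)
      fix v assume v: "v \<in> {v \<in> {0..<n}. v \<noteq> u \<and> v mod r = u mod r}"
      then have "v div r \<noteq> u div r" by (metis (mono_tags, lifting) div_mult_mod_eq mem_Collect_eq)
      moreover have "v div r \<le> (n - 1) div r" using v by (intro div_le_mono) auto
      ultimately show "v div r \<in> {0..(n - 1) div r} - {u div r}" by auto
    qed
  qed simp
  also have "\<dots> = (n - 1) div r"
    using assms by (subst card_Diff_singleton) (auto intro: div_le_mono)
  finally show ?thesis .
qed

text \<open>All classes have size \<open>m\<close> or \<open>m + 1\<close>. Each class gets its own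
  residue \<open>p i\<close> and is listed along it as \<open>p i\<close>, \<open>r + p i\<close>
  and so on; the classes of size \<open>m + 1\<close> need the smallest residues to stay below
  \<open>n\<close>.\<close>

lemma balanced_colouring_into_turan:
  fixes col :: "'b \<Rightarrow> nat"
  assumes "finite V" "card V = n" "r > 0" and col: "\<And>v. v \<in> V \<Longrightarrow> col v < r"
    and bal: "\<And>i j. i < r \<Longrightarrow> j < r \<Longrightarrow> card {v \<in> V. col v = i} \<le> card {v \<in> V. col v = j} + 1"
  shows "\<exists>h. inj_on h V \<and> h ` V \<subseteq> {0..<n} \<and> (\<forall>u\<in>V. \<forall>v\<in>V. col u \<noteq> col v \<longrightarrow> h u mod r \<noteq> h v mod r)"
proof -
  define s where "s = (\<lambda>i. card {v \<in> V. col v = i})"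
  define m where "m = Min (s ` {..<r})"
  have m: "m \<le> s i" if "i < r" for i using that unfolding m_def by (intro Min_le) auto
  have "m \<in> s ` {..<r}" unfolding m_def using assms(3) by (intro Min_in) auto
  then obtain i0 where i0: "i0 < r" "s i0 = m" by auto
  have s: "s i = m \<or> s i = m + 1" if "i < r" for i
    using m[OF that] bal[OF that i0(1)] i0(2) by (auto simp: s_def)
  define L where "L = {i. i < r \<and> s i = m + 1}"
  have L: "L \<subseteq> {..<r} - {i0}" "finite L" using i0 by (auto simp: L_def)
  \<comment> \<open>The class \<open>i0\<close> of minimal size is not in \<open>L\<close>; so
    \<open>n = r * m + card L\<close> below is division with remainder.\<close>
  have cL: "card L < r" using card_mono[OF _ L(1)] i0(1) by simp
  have "n = (\<Sum>i<r. s i)"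
  proof -
    have "V = (\<Union>i<r. {v \<in> V. col v = i})" using col by auto
    then have "card V = card (\<Union>i<r. {v \<in> V. col v = i})" by simp
    also have "\<dots> = (\<Sum>i<r. card {v \<in> V. col v = i})"
      using assms(1) by (intro card_UN_disjoint) auto
    finally show ?thesis using assms(2) by (simp add: s_def)
  qed
  also have "\<dots> = (\<Sum>i<r. m + (if i \<in> L then 1 else 0))"
    using s by (intro sum.cong) (auto simp: L_def)
  also have "\<dots> = r * m + card ({..<r} \<inter> L)" by (simp add: sum.distrib sum.If_cases)
  also have "{..<r} \<inter> L = L" using L by auto
  finally have n: "n = r * m + card L" .
  obtain f1 where f1: "bij_betw f1 L {0..<card L}" using ex_bij_betw_finite_nat[OF L(2)] by blast
  obtain f2 where f2: "bij_betw f2 ({..<r} - L) {0..<card ({..<r} - L)}"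
    using ex_bij_betw_finite_nat[of "{..<r} - L"] by blast
  have cL2: "card ({..<r} - L) = r - card L" using L by (subst card_Diff_subset) auto
  define p where "p = (\<lambda>i. if i \<in> L then f1 i else f2 i + card L)"
  have pL: "p i < card L" if "i \<in> L" for i using bij_betwE[OF f1] that by (auto simp: p_def)
  have pr: "p i < r" if "i < r" for i
  proof (cases "i \<in> L")
    case False
    then have "f2 i < r - card L" using bij_betwE[OF f2] that cL2 by auto
    then show ?thesis using False by (simp add: p_def)
  qed (use pL cL in fastforce)
  have pinj: "p i \<noteq> p j" if "i < r" "j < r" "i \<noteq> j" for i j
    using pL[of i] pL[of j] that inj_onD[OF bij_betw_imp_inj_on[OF f1], of i j]
      inj_onD[OF bij_betw_imp_inj_on[OF f2], of i j] by (auto simp: p_def split: if_splits)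
  have "\<forall>i. \<exists>e. bij_betw e {v \<in> V. col v = i} {0..<s i}"
    unfolding s_def using assms(1) by (auto intro: ex_bij_betw_finite_nat)
  then obtain e where e: "\<And>i. bij_betw (e i) {v \<in> V. col v = i} {0..<s i}" by metis
  define h where "h = (\<lambda>v. e (col v) v * r + p (col v))"
  have hm: "h v mod r = p (col v)" "h v div r = e (col v) v" if "v \<in> V" for v
    using pr[OF col[OF that]] by (simp_all add: h_def)
  have "inj_on h V"
  proof (rule inj_onI)
    fix u v assume uv: "u \<in> V" "v \<in> V" "h u = h v"
    then have c: "col u = col v" using hm pinj col by metis
    then have "e (col u) u = e (col u) v" using hm uv by metis
    then show "u = v" using inj_onD[OF bij_betw_imp_inj_on[OF e[of "col u"]], of u v] uv c by auto
  qed
  moreover have "h v < n" if v: "v \<in> V" for v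
  proof -
    have ev: "e (col v) v < s (col v)" using bij_betwE[OF e[of "col v"]] v by auto
    show ?thesis
    proof (cases "col v \<in> L")
      case True
      then have "e (col v) v \<le> m" using ev by (simp add: L_def)
      then have "e (col v) v * r \<le> r * m" by (metis mult.commute mult_le_mono1)
      then show ?thesis unfolding h_def n using pL[OF True] by linarith
    next
      case False
      then have "Suc (e (col v) v) \<le> m" using ev s[OF col[OF v]] col[OF v] by (auto simp: L_def)
      then have "Suc (e (col v) v) * r \<le> r * m" by (metis mult.commute mult_le_mono1)
      then show ?thesis unfolding h_def n using pr[OF col[OF v]] by simp
    qed
  qed
  moreover have "h u mod r \<noteq> h v mod r" if "u \<in> V" "v \<in> V" "col u \<noteq> col v" for u v
    using that hm pinj col by simp
  ultimately show ?thesis by (intro exI[of _ h]) auto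
qed

section \<open>Orienting the edges and final assembly\<close>

lemma inj_count_eq_card_emb:
  assumes "sgraph VH EH" and sym: "\<And>u v. E u v \<Longrightarrow> E v u"
    and P: "\<And>x y. (x, y) \<in> P \<Longrightarrow> EH x y" "\<And>x y. EH x y \<Longrightarrow> (x, y) \<in> P \<or> (y, x) \<in> P"
  shows "inj_count VH EH V E = card (emb VH P V E)"
proof -
  have "(\<forall>u v. EH u v \<longrightarrow> E (f u) (f v)) \<longleftrightarrow> (\<forall>(x, y)\<in>P. E (f x) (f y))" for f
    using P sym by blast
  then show ?thesis
    unfolding inj_count_def emb_def graph_hom_def by (intro arg_cong[where f = card]) auto
qed

text \<open>Number the vertices and direct each edge towards its larger end.\<close>

lemma ex_orientation:
  assumes "sgraph VH EH"
  shows "\<exists>P. P \<subseteq> VH \<times> VH \<and> (\<forall>x y. (x, y) \<in> P \<longrightarrow> EH x y \<and> (y, x) \<notin> P)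
    \<and> (\<forall>x y. EH x y \<longrightarrow> (x, y) \<in> P \<or> (y, x) \<in> P)"
proof -
  have H: "finite VH" "\<And>u v. EH u v \<Longrightarrow> u \<in> VH \<and> v \<in> VH" "\<And>u v. EH u v \<Longrightarrow> EH v u" "\<And>v. \<not> EH v v"
    using assms unfolding sgraph_def by auto
  obtain g :: "'a \<Rightarrow> nat" where g: "inj_on g VH" using finite_imp_inj_to_nat_seg[OF H(1)] by blast
  have lt: "g x < g y \<or> g y < g x" if "EH x y" for x y
    using that H g by (metis inj_onD linorder_neqE_nat)
  show ?thesis
    by (rule exI[of _ "{(x, y). EH x y \<and> g x < g y}"]) (use H lt in auto)
qed

lemma card_emb_le_turan:
  fixes V :: "nat set"
  assumes pat: "pattern A P V" and V: "V = {0..<n}" and r: "r \<ge> 300 * card A ^ 9" and rn: "r < n"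
    and G: "\<And>u v. E u v \<Longrightarrow> E v u" "\<And>v. \<not> E v v" "\<not> contains_clique V E (Suc r)"
  shows "card (emb A P V E) \<le> card (emb A P V (\<lambda>i j. i mod r \<noteq> j mod r))"
proof -
  interpret pattern A P V by (rule pat)
  define k where "k = card A"
  have k2: "k \<ge> 2" using card_A_ge by (simp add: k_def)
  have cV: "card V = n" using V by simp
  have r0: "r > 0"
  proof -
    have "k ^ 9 > 0" using k2 by simp
    then show ?thesis using r unfolding k_def by linarith
  qed
  define ok :: "(nat \<Rightarrow> nat \<Rightarrow> bool) \<Rightarrow> bool" where
    "ok = (\<lambda>E. (\<forall>u v. E u v \<longrightarrow> E v u) \<and> (\<forall>v. \<not> E v v) \<and> \<not> contains_clique V E (Suc r))"
  have okc: "ok (\<lambda>u v. c u \<noteq> c v)" if "\<And>v. v \<in> V \<Longrightarrow> c v < r" for c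
    using multipartite_clique_free[of V c r] that by (auto simp: ok_def)
  have bound: "card (emb A P V F) \<le> card (A \<rightarrow>\<^sub>E V)" for F
    using finA finV by (intro card_mono finite_PiE) (auto simp: emb_def)
  have "ok E" using G by (auto simp: ok_def)
  \<comment> \<open>An extremal graph exists since all counts are bounded by the number of maps from
    \<open>A\<close> to \<open>V\<close>.\<close>
  then have "\<exists>X. ok X \<and> (\<forall>F. ok F \<longrightarrow> card (emb A P V F) \<le> card (emb A P V X))"
    using bound by (intro ex_has_greatest_nat[where b = "Suc (card (A \<rightarrow>\<^sub>E V))"]) (auto simp: less_Suc_eq_le)
  then obtain X where X: "ok X" "\<And>F. ok F \<Longrightarrow> card (emb A P V F) \<le> card (emb A P V X)" by auto
  have symX: "X u v \<Longrightarrow> X v u" and irrX: "\<not> X v v" and freeX: "\<not> contains_clique V X (Suc r)" for u v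
    using X(1) by (auto simp: ok_def)
  let ?T = "emb A P V (\<lambda>i j. i mod r \<noteq> j mod r)"
  \<comment> \<open>The Turan graph is a competitor of \<open>X\<close>, and its complement degrees
    are at most \<open>(n - 1) div r\<close>, which is at most \<open>n / r\<close>.\<close>
  have many: "r * N 0 \<le> r * card (emb A P V X) + 2 * card P * N 0"
  proof -
    have "card V * N 0 \<le> card V * card ?T + 2 * card P * ((n - 1) div r) * N 0"
    proof (rule card_emb_ge)
      fix u assume u: "u \<in> V"
      have "{v \<in> V. v \<noteq> u \<and> \<not> u mod r \<noteq> v mod r} = {v \<in> {0..<n}. v \<noteq> u \<and> v mod r = u mod r}"
        unfolding V by auto
      then show "card {v \<in> V. v \<noteq> u \<and> \<not> u mod r \<noteq> v mod r} \<le> (n - 1) div r"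
        using card_cong_class_le[of u n r] r0 u V by simp
    qed auto
    then have "r * (n * N 0) \<le> r * (n * card ?T + 2 * card P * ((n - 1) div r) * N 0)"
      unfolding cV by (rule mult_le_mono2)
    also have "\<dots> = r * (n * card ?T) + 2 * card P * (r * ((n - 1) div r)) * N 0"
      by (simp add: algebra_simps)
    also have "\<dots> \<le> r * (n * card ?T) + 2 * card P * n * N 0"
    proof (intro add_left_mono mult_right_mono mult_left_mono)
      have "r * ((n - 1) div r) \<le> n - 1" by simp
      then show "r * ((n - 1) div r) \<le> n" by linarith
    qed auto
    finally have "n * (r * N 0) \<le> n * (r * card ?T + 2 * card P * N 0)" by (simp add: algebra_simps)
    then have "r * N 0 \<le> r * card ?T + 2 * card P * N 0" using rn by simp
    also have "card ?T \<le> card (emb A P V X)" using X(2) okc[of "\<lambda>i. i mod r"] r0 by simp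
    finally show ?thesis by simp
  qed
  \<comment> \<open>The codegree bound \<open>3 * k ^ 3 * n / r\<close> with
    \<open>r >= 300 * k ^ 9\<close> is at most \<open>n / (100 * k ^ 6)\<close>.\<close>
  define D where "D = n div (100 * k ^ 6)"
  have D: "100 * k ^ 6 * D \<le> n" by (simp add: D_def)
  have codeg: "card {w \<in> V. w \<noteq> v \<and> \<not> X v w} \<le> D" if v: "v \<in> V" for v
  proof -
    let ?C = "card {w \<in> V. w \<noteq> v \<and> \<not> X v w}"
    have "r * ?C \<le> 3 * k ^ 3 * n"
      unfolding k_def cV[symmetric]
      by (rule extremal_codegree_le[OF symX irrX freeX _ many _ v]) (use X(2) rn cV in \<open>auto simp: ok_def\<close>)
    moreover have "300 * k ^ 9 * ?C \<le> r * ?C" using r by (intro mult_right_mono) (auto simp: k_def)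
    ultimately have "300 * k ^ 9 * ?C \<le> 3 * k ^ 3 * n" by linarith
    moreover have "300 * k ^ 9 * ?C = (3 * k ^ 3) * (100 * k ^ 6 * ?C)"
      by (simp add: power_add[symmetric])
    ultimately have "(3 * k ^ 3) * (100 * k ^ 6 * ?C) \<le> (3 * k ^ 3) * n" by (simp only:)
    moreover have "0 < 3 * k ^ 3" using k2 by simp
    ultimately have "100 * k ^ 6 * ?C \<le> n" by (rule mult_left_le_imp_le)
    then show ?thesis unfolding D_def using k2
      by (simp add: less_eq_div_iff_mult_less_eq mult.commute)
  qed
  obtain col where col: "\<And>v. v \<in> V \<Longrightarrow> col v < r"
    and BM: "2 * card (SIGMA u:V. {v \<in> V. X u v \<and> col v = col u}) \<le> card (SIGMA u:V. {v \<in> V. \<not> X u v \<and> col v \<noteq> col u})"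
    and parts: "\<And>v. v \<in> V \<Longrightarrow> \<exists>x\<in>V. {w \<in> V. col w = col v} \<subseteq> {w \<in> V. \<not> X x w}"
    using furedi_colouring[OF symX irrX finV freeX] by blast
  have part: "card {w \<in> V. w \<noteq> u \<and> col w = col u} \<le> D" if u: "u \<in> V" for u
  proof -
    obtain x where x: "x \<in> V" "{w \<in> V. col w = col u} \<subseteq> {w \<in> V. \<not> X x w}" using parts[OF u] by blast
    \<comment> \<open>The class contains \<open>u\<close> and the set of non-neighbours of
      \<open>x\<close> contains \<open>x\<close>; removing one vertex from each side keeps the
      inequality.\<close>
    have 1: "{w \<in> V. col w = col u} = insert u {w \<in> V. w \<noteq> u \<and> col w = col u}" using u by auto
    have 2: "{w \<in> V. \<not> X x w} = insert x {w \<in> V. w \<noteq> x \<and> \<not> X x w}" using x irrX by auto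
    have "card {w \<in> V. col w = col u} \<le> card {w \<in> V. \<not> X x w}"
      using x(2) finV by (intro card_mono) auto
    then have "card {w \<in> V. w \<noteq> u \<and> col w = col u} \<le> card {w \<in> V. w \<noteq> x \<and> \<not> X x w}"
      unfolding 1 2 using finV by simp
    then show ?thesis using codeg[OF x(1)] by simp
  qed
  have kp: "k ^ 2 \<le> k ^ 6" "k ^ 3 \<le> k ^ 6" using k2 by (auto intro: power_increasing)
  have cP: "card P \<le> k ^ 6" using card_P_le kp(1) by (simp add: k_def power2_eq_square)
  have "8 * card P * D \<le> 100 * k ^ 6 * D" using cP by (intro mult_right_mono) auto
  then have "8 * card P * D \<le> card V" using D cV by linarith
  then have XK: "card (emb A P V X) \<le> card (emb A P V (\<lambda>u v. col u \<noteq> col v))"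
    by (intro card_emb_le_multipartite[OF symX codeg part _ BM irrX])
  have small: "2 * card P * D + 2 * card A ^ 3 * D < card V"
  proof -
    have 1: "card P * D \<le> k ^ 6 * D" "card A ^ 3 * D \<le> k ^ 6 * D"
      using cP kp(2) by (auto intro!: mult_right_mono simp: k_def)
    have 2: "100 * (k ^ 6 * D) \<le> n" using D by (simp only: mult.assoc)
    have "2 * (card P * D) + 2 * (card A ^ 3 * D) < card V"
      using 1 2 rn cV by linarith
    then show ?thesis by (simp only: mult.assoc)
  qed
  \<comment> \<open>By \<open>XK\<close> the multipartite graph of \<open>col\<close> is extremal
    too, so no recolouring can improve it.\<close>
  have bal: "card {v \<in> V. col v = i} \<le> card {v \<in> V. col v = j} + 1" if ij: "i < r" "j < r" for i j
  proof (rule ccontr)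
    assume "\<not> ?thesis"
    then have *: "card {v \<in> V. col v = j} + 2 \<le> card {v \<in> V. col v = i}" by simp
    then have "card {v \<in> V. col v = i} \<noteq> 0" by linarith
    then have "{v \<in> V. col v = i} \<noteq> {}" by force
    then obtain v where v: "v \<in> V" "col v = i" by blast
    have "j \<noteq> i" using * by auto
    then have "card (emb A P V (\<lambda>a b. col a \<noteq> col b))
        < card (emb A P V (\<lambda>a b. (col(v := j)) a \<noteq> (col(v := j)) b))"
      using unbalanced_improvable[OF v(1) _ part _ small, of j] * v(2) by blast
    also have "\<dots> \<le> card (emb A P V X)" by (intro X(2) okc) (use col ij in auto)
    finally show False using XK by simp
  qed
  obtain h where h: "inj_on h V \<and> h ` V \<subseteq> {0..<n}
      \<and> (\<forall>u\<in>V. \<forall>v\<in>V. col u \<noteq> col v \<longrightarrow> h u mod r \<noteq> h v mod r)"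
    using balanced_colouring_into_turan[OF finV cV r0 col bal] by (rule exE)
  have "card (emb A P V E) \<le> card (emb A P V X)" using X(2) \<open>ok E\<close> by blast
  also note XK
  also have "card (emb A P V (\<lambda>u v. col u \<noteq> col v)) \<le> card ?T"
    using h unfolding V[symmetric] by (intro card_emb_mono_map[OF finA finV P_sub, where h = h]) simp_all
  finally show ?thesis .
qed

theorem theorem1p3:
  fixes VH :: "'a set" and EH :: "'a \<Rightarrow> 'a \<Rightarrow> bool"
    and VG :: "'b set" and EG :: "'b \<Rightarrow> 'b \<Rightarrow> bool"
    and r n :: nat
  assumes "sgraph VH EH"
    and "r \<ge> 300 * card VH ^ 9"
    and "n > 0"
    and "sgraph VG EG" and "card VG = n"
    and "\<not> contains_clique VG EG (r + 1)"
  shows "inj_count VH EH VG EG \<le> inj_count VH EH (turan_V n) (turan_E r n)"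
proof -
  have H: "finite VH" using assms(1) by (simp add: sgraph_def)
  have G: "finite VG" "\<And>u v. EG u v \<Longrightarrow> EG v u" "\<And>v. \<not> EG v v"
    using assms(4) by (auto simp: sgraph_def)
  obtain P where P: "P \<subseteq> VH \<times> VH" "\<And>x y. (x, y) \<in> P \<Longrightarrow> EH x y" "\<And>x y. (x, y) \<in> P \<Longrightarrow> (y, x) \<notin> P"
    "\<And>x y. EH x y \<Longrightarrow> (x, y) \<in> P \<or> (y, x) \<in> P"
    using ex_orientation[OF assms(1)] by blast
  obtain h where h: "bij_betw h VG {0..<n}" using ex_bij_betw_finite_nat[OF G(1)] assms(5) by blast
  have hinj: "inj_on h VG" and him: "h ` VG = {0..<n}" using h by (auto simp: bij_betw_def)
  have "card (emb VH P VG EG) \<le> card (emb VH P {0..<n} (turan_E r n))"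
  \<comment> \<open>Without edges all injections count, and for \<open>n <= r\<close> the Turan
    graph is complete; in both cases the bijection \<open>h\<close> transfers embeddings.\<close>
  proof (cases "P = {} \<or> n \<le> r")
    case True
    then show ?thesis
    proof
      assume "P = {}"
      then have "emb VH P VG EG = emb VH P VG (\<lambda>_ _. False)" by (simp add: emb_def)
      then show ?thesis using card_emb_mono_map[OF H _ P(1) hinj, of "{0..<n}" "\<lambda>_ _. False"] him by simp
    next
      assume nr: "n \<le> r"
      show ?thesis
      proof (rule card_emb_mono_map[OF H _ P(1) hinj])
        fix u v assume uv: "u \<in> VG" "v \<in> VG" "EG u v"
        then have "h u \<noteq> h v" using hinj G(3) by (metis inj_onD)
        moreover have "h u < n" "h v < n" using uv him by auto
        ultimately show "turan_E r n (h u) (h v)" using nr by (simp add: turan_E_def)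
      qed (use him in auto)
    qed
  next
    case False
    \<comment> \<open>The graph is moved to \<open>{0..<n}\<close> so that it competes on the vertex
      set of the Turan graph.\<close>
    let ?g = "inv_into VG h"
    let ?E = "\<lambda>i j. EG (?g i) (?g j)"
    have k0: "card VH > 0" using False P(1) H by (auto simp: card_gt_0_iff)
    have pat: "pattern VH P {0..<n}"
    proof
      have "card VH \<le> card VH ^ 9" using self_le_power[of "card VH" 9] k0 by simp
      then show "2 * card VH \<le> card {0..<n}" using assms(2) False by simp
    qed (use H P False in auto)
    have "card (emb VH P VG EG) \<le> card (emb VH P {0..<n} ?E)"
      using hinj him by (intro card_emb_mono_map[OF H _ P(1) hinj]) auto
    also have "\<dots> \<le> card (emb VH P {0..<n} (\<lambda>i j. i mod r \<noteq> j mod r))"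
    proof (rule card_emb_le_turan[OF pat refl assms(2)])
      show "\<not> contains_clique {0..<n} ?E (Suc r)"
      proof (rule clique_free_pullback[OF G(3)])
        show "?g ` {0..<n} \<subseteq> VG" using him by (auto intro: inv_into_into)
      qed (use assms(6) in simp)
    qed (use False G in auto)
    also have "emb VH P {0..<n} (\<lambda>i j. i mod r \<noteq> j mod r) = emb VH P {0..<n} (turan_E r n)"
    proof -
      have "(\<forall>(x, y)\<in>P. f x mod r \<noteq> f y mod r) \<longleftrightarrow> (\<forall>(x, y)\<in>P. turan_E r n (f x) (f y))"
        if "f \<in> VH \<rightarrow>\<^sub>E {0..<n}" for f
      proof -
        have "f x < n \<and> f y < n" if "(x, y) \<in> P" for x y
          using that P(1) \<open>f \<in> VH \<rightarrow>\<^sub>E {0..<n}\<close> by (auto simp: PiE_iff)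
        then show ?thesis by (auto simp: turan_E_def)
      qed
      then show ?thesis unfolding emb_def by blast
    qed
    finally show ?thesis .
  qed
  moreover have "turan_E r n i j \<Longrightarrow> turan_E r n j i" for i j by (auto simp: turan_E_def)
  ultimately show ?thesis
    using inj_count_eq_card_emb[OF assms(1) G(2) P(2,4), where V = VG]
      inj_count_eq_card_emb[OF assms(1) _ P(2,4), where E = "turan_E r n" and V = "{0..<n}"]
    by (simp add: turan_V_def)
qed

end
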